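(* Let $p\geq 1$, $q\geq 0$ be integers. Any isometry of $\mathbb H^{p,q}$ can be written in $\mathcal H^{p,q}$ as the composition of elements of $G$ and $\mathcal J$; that is, $\mathrm{Isom}(\mathbb H^{p,q})$ is generated by the extensions to $\mathbb H^{p,q}$ (via $\iota_{p,q}$) of the elements of $G$ and of $\mathcal J$.
   Context: The half-space model is $\mathcal H^{p,q}=\{(x,y,z)\in\mathbb R^{p-1}\oplus\mathbb R^q\oplus\mathbb R:z>0\}$ with the pseudo-Riemannian metric $\frac{dx_1^2+\dots+dx_{p-1}^2-dy_1^2-\dots-dy_q^2+dz^2}{z^2}$. $\mathbb R^{p,q+1}$ is $\mathbb R^{p+q+1}$ with the form $\langle X,Y\rangle=\sum_{i\le p}X_iY_i-\sum_{i=p+1}^{p+q+1}X_iY_i$, and $\mathbb H^{p,q}=\{X\in\mathbb R^{p,q+1}:\langle X,X\rangle=-1\}/\{\pm\mathrm{Id}\}$ with the induced metric. The isometric embedding $\iota_{p,q}\colon\mathcal H^{p,q}\to\mathbb H^{p,q}$ is $$\iota_{p,q}(x,y,z)=\left[\frac{x}{z}:\frac{1-h(x,y)-z^2}{2z}:\frac{y}{z}:\frac{1+h(x,y)+z^2}{2z}\right],\quad h(x,y)=\|x\|^2-\|y\|^2$$ (entries in order: coordinates $1,\dots,p-1$; $p$; $p+1,\dots,p+q$; $p+q+1$). $G$ is the group of isometries of $\mathcal H^{p,q}$ of the form $(x,y,z)\mapsto\lambda\,(A(x,y)+(x_0,y_0),z)$ with $\lambda>0$, $A\in\mathrm O(p-1,q)$,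 $(x_0,y_0)\in\mathbb R^{p-1}\oplus\mathbb R^q$. The inversion $\mathcal J$ is defined on $\{(x,y,z)\in\mathcal H^{p,q}:\|x\|^2-\|y\|^2+z^2\neq0\}$ by $\mathcal J(x,y,z)=(\mu x,\mu y,|\mu|z)$ with $\mu=(\|x\|^2-\|y\|^2+z^2)^{-1}$. Each $g\in G$, and $\mathcal J$, extends via $\iota_{p,q}$ to a global isometry $\hat g$ of $\mathbb H^{p,q}$, i.e. $\hat g\circ\iota_{p,q}=\iota_{p,q}\circ g$ on the domain of definition of $g$. *)

theory Defs
  imports "HOL-Analysis.Analysis" "HOL-Algebra.Bij" "HOL-Algebra.Generated_Groups"
begin

text \<open>
  The dimensions \<open>p + q\<close> and \<open>p + q + 1\<close> are carried by index types \<open>'m\<close> and \<open>'n\<close>. Coordinates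
  are numbered by bijections \<open>e\<close> from \<open>{1..p+q}\<close> to \<open>'m\<close> and \<open>c\<close> from \<open>{1..p+q+1}\<close> to \<open>'n\<close>, so
  that the \<open>i\<close>-th coordinate of \<open>v\<close> is \<open>v $ e i\<close> (or \<open>v $ c i\<close>). Numbering the coordinates in
  this way, rather than using one type per summand, allows \<open>\<real>\<^sup>p\<^sup>-\<^sup>1\<close> and \<open>\<real>\<^sup>q\<close> to be zero.
\<close>

definition from_coords :: "nat \<Rightarrow> (nat \<Rightarrow> 'n) \<Rightarrow> (nat \<Rightarrow> real) \<Rightarrow> real ^ 'n::finite" where
  "from_coords d c a = (\<Sum>i=1..d. a i *\<^sub>R axis (c i) 1)"

definition form :: "nat \<Rightarrow> nat \<Rightarrow> (nat \<Rightarrow> 'n) \<Rightarrow> real ^ 'n::finite \<Rightarrow> real ^ 'n \<Rightarrow> real" where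
  "form r s c u v = (\<Sum>i=1..r. u $ c i * v $ c i) - (\<Sum>i=r+1..r+s. u $ c i * v $ c i)"


subsection \<open>Smooth maps on open sets\<close>

fun Ck_on :: "nat \<Rightarrow> 'a::real_normed_vector set \<Rightarrow> ('a \<Rightarrow> 'b::real_normed_vector) \<Rightarrow> bool" where
  "Ck_on 0 U f \<longleftrightarrow> continuous_on U f"
| "Ck_on (Suc k) U f \<longleftrightarrow> (\<forall>x\<in>U. f differentiable (at x)) \<and>
     (\<forall>v. Ck_on k U (\<lambda>x. frechet_derivative f (at x) v))"

definition smooth_on :: "'a::real_normed_vector set \<Rightarrow> ('a \<Rightarrow> 'b::real_normed_vector) \<Rightarrow> bool" where
  "smooth_on U f \<longleftrightarrow> (\<forall>k. Ck_on k U f)"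


subsection \<open>The quotient of the quadric by \<open>{\<plusminus>Id}\<close> and its isometry group\<close>

definition quadric :: "nat \<Rightarrow> nat \<Rightarrow> (nat \<Rightarrow> 'n) \<Rightarrow> (real ^ 'n::finite) set" where
  "quadric p q c = {X. form p (q + 1) c X X = -1}"

definition tangent :: "nat \<Rightarrow> nat \<Rightarrow> (nat \<Rightarrow> 'n) \<Rightarrow> real ^ 'n::finite \<Rightarrow> (real ^ 'n) set" where
  "tangent p q c X = {v. form p (q + 1) c X v = 0}"

text \<open>The orbit of \<open>X\<close> under \<open>{\<plusminus>Id}\<close>.\<close>

definition orb :: "real ^ 'n::finite \<Rightarrow> (real ^ 'n) set" where
  "orb X = {X, - X}"

definition Hpq :: "nat \<Rightarrow> nat \<Rightarrow> (nat \<Rightarrow> 'n) \<Rightarrow> (real ^ 'n::finite) set set" where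
  "Hpq p q c = orb ` quadric p q c"

text \<open>
  The projection \<open>orb\<close> from the quadric to the quotient is a local diffeomorphism (indeed a local
  isometry), so smoothness and differentials of a self-map \<open>F\<close> of the quotient are read off from
  local lifts of \<open>F\<close> to the quadric. As the quadric is a submanifold, a lift near \<open>X\<close> is smooth iff
  it is the restriction of a smooth map \<open>\<Phi>\<close> on a neighbourhood \<open>U\<close> of \<open>X\<close> in the ambient space, and
  its differential is the restriction of the derivative of \<open>\<Phi>\<close> to the tangent space.
\<close>

definition smooth_lift_at ::
  "nat \<Rightarrow> nat \<Rightarrow> (nat \<Rightarrow> 'n) \<Rightarrow> ((real ^ 'n::finite) set \<Rightarrow> (real ^ 'n) set) \<Rightarrow> real ^ 'n \<Rightarrow>
   (real ^ 'n \<Rightarrow> real ^ 'n) \<Rightarrow> bool" where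
  "smooth_lift_at p q c F X \<Phi> \<longleftrightarrow> (\<exists>U. open U \<and> X \<in> U \<and> smooth_on U \<Phi> \<and>
     (\<forall>Y\<in>U \<inter> quadric p q c. \<Phi> Y \<in> quadric p q c \<and> F (orb Y) = orb (\<Phi> Y)))"

definition smooth_self_map ::
  "nat \<Rightarrow> nat \<Rightarrow> (nat \<Rightarrow> 'n) \<Rightarrow> ((real ^ 'n::finite) set \<Rightarrow> (real ^ 'n) set) \<Rightarrow> bool" where
  "smooth_self_map p q c F \<longleftrightarrow> (\<forall>X\<in>quadric p q c. \<exists>\<Phi>. smooth_lift_at p q c F X \<Phi>)"

definition preserves_metric ::
  "nat \<Rightarrow> nat \<Rightarrow> (nat \<Rightarrow> 'n) \<Rightarrow> ((real ^ 'n::finite) set \<Rightarrow> (real ^ 'n) set) \<Rightarrow> bool" where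
  "preserves_metric p q c F \<longleftrightarrow> (\<forall>X\<in>quadric p q c. \<exists>\<Phi>. smooth_lift_at p q c F X \<Phi> \<and>
     (\<forall>v\<in>tangent p q c X. \<forall>w\<in>tangent p q c X.
        form p (q + 1) c (frechet_derivative \<Phi> (at X) v) (frechet_derivative \<Phi> (at X) w)
          = form p (q + 1) c v w))"

text \<open>
  Self-maps are taken in \<^const>\<open>Bij\<close>, hence are \<^const>\<open>undefined\<close> off the manifold; the group
  operation is that of \<^const>\<open>BijGroup\<close>.
\<close>

definition Isom ::
  "nat \<Rightarrow> nat \<Rightarrow> (nat \<Rightarrow> 'n) \<Rightarrow> ((real ^ 'n::finite) set \<Rightarrow> (real ^ 'n) set) set" where
  "Isom p q c = {F \<in> Bij (Hpq p q c). smooth_self_map p q c F \<and>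
     smooth_self_map p q c (inv_into (Hpq p q c) F) \<and> preserves_metric p q c F}"


subsection \<open>The half-space model\<close>

text \<open>
  In \<open>\<real>\<^sup>p\<^sup>-\<^sup>1 \<oplus> \<real>\<^sup>q \<oplus> \<real>\<close> the coordinates \<open>1, \<dots>, p-1\<close> are those of \<open>x\<close>, the coordinates
  \<open>p, \<dots>, p+q-1\<close> those of \<open>y\<close>, and the coordinate \<open>p+q\<close> is \<open>z\<close>. Thus \<open>form (p - 1) q e\<close> is the
  bilinear form of \<open>h\<close>; it ignores the coordinate \<open>z\<close>.
\<close>

definition zc :: "nat \<Rightarrow> nat \<Rightarrow> (nat \<Rightarrow> 'm) \<Rightarrow> real ^ 'm::finite \<Rightarrow> real" where
  "zc p q e P = P $ e (p + q)"

text \<open>\<open>horiz\<close> is \<open>\<real>\<^sup>p\<^sup>-\<^sup>1 \<oplus> \<real>\<^sup>q \<oplus> 0\<close>; \<open>hor\<close> maps \<open>(x,y,z)\<close> to \<open>(x,y,0)\<close> and \<open>vert\<close> maps \<open>t\<close> to \<open>(0,0,t)\<close>.\<close>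

definition horiz :: "nat \<Rightarrow> nat \<Rightarrow> (nat \<Rightarrow> 'm) \<Rightarrow> (real ^ 'm::finite) set" where
  "horiz p q e = {v. zc p q e v = 0}"

definition vert :: "nat \<Rightarrow> nat \<Rightarrow> (nat \<Rightarrow> 'm) \<Rightarrow> real \<Rightarrow> real ^ 'm::finite" where
  "vert p q e t = t *\<^sub>R axis (e (p + q)) 1"

definition hor :: "nat \<Rightarrow> nat \<Rightarrow> (nat \<Rightarrow> 'm) \<Rightarrow> real ^ 'm::finite \<Rightarrow> real ^ 'm" where
  "hor p q e P = P - vert p q e (zc p q e P)"

definition h :: "nat \<Rightarrow> nat \<Rightarrow> (nat \<Rightarrow> 'm) \<Rightarrow> real ^ 'm::finite \<Rightarrow> real" where
  "h p q e P = form (p - 1) q e P P"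

definition half_space :: "nat \<Rightarrow> nat \<Rightarrow> (nat \<Rightarrow> 'm) \<Rightarrow> (real ^ 'm::finite) set" where
  "half_space p q e = {P. zc p q e P > 0}"

definition hs_metric ::
  "nat \<Rightarrow> nat \<Rightarrow> (nat \<Rightarrow> 'm) \<Rightarrow> real ^ 'm::finite \<Rightarrow> real ^ 'm \<Rightarrow> real ^ 'm \<Rightarrow> real" where
  "hs_metric p q e P u v =
     (form (p - 1) q e u v + zc p q e u * zc p q e v) / (zc p q e P)\<^sup>2"

definition hs_isometry ::
  "nat \<Rightarrow> nat \<Rightarrow> (nat \<Rightarrow> 'm) \<Rightarrow> (real ^ 'm::finite \<Rightarrow> real ^ 'm) \<Rightarrow> bool" where
  "hs_isometry p q e g \<longleftrightarrow>
     bij_betw g (half_space p q e) (half_space p q e) \<and>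
     smooth_on (half_space p q e) g \<and>
     smooth_on (half_space p q e) (inv_into (half_space p q e) g) \<and>
     (\<forall>P\<in>half_space p q e. \<forall>u v.
        hs_metric p q e (g P) (frechet_derivative g (at P) u) (frechet_derivative g (at P) v)
          = hs_metric p q e P u v)"

text \<open>
  An element of \<open>O(p-1,q)\<close> is given by a linear map of the ambient space that restricts to an
  endomorphism of \<^const>\<open>horiz\<close> preserving the form; only this restriction is used. Bijectivity of
  the restriction follows, the form being nondegenerate on \<^const>\<open>horiz\<close>.
\<close>

definition orth :: "nat \<Rightarrow> nat \<Rightarrow> (nat \<Rightarrow> 'm) \<Rightarrow> (real ^ 'm::finite \<Rightarrow> real ^ 'm) set" where
  "orth p q e = {A. linear A \<and> A ` horiz p q e \<subseteq> horiz p q e \<and>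
     (\<forall>u\<in>horiz p q e. \<forall>v\<in>horiz p q e. form (p - 1) q e (A u) (A v) = form (p - 1) q e u v)}"

definition G :: "nat \<Rightarrow> nat \<Rightarrow> (nat \<Rightarrow> 'm) \<Rightarrow> (real ^ 'm::finite \<Rightarrow> real ^ 'm) set" where
  "G p q e = {g. hs_isometry p q e g \<and>
     (\<exists>lam>0. \<exists>A\<in>orth p q e. \<exists>t\<in>horiz p q e. \<forall>P\<in>half_space p q e.
        g P = lam *\<^sub>R (A (hor p q e P) + t + vert p q e (zc p q e P)))}"

definition J_dom :: "nat \<Rightarrow> nat \<Rightarrow> (nat \<Rightarrow> 'm) \<Rightarrow> (real ^ 'm::finite) set" where
  "J_dom p q e = {P \<in> half_space p q e. h p q e P + (zc p q e P)\<^sup>2 \<noteq> 0}"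

definition J :: "nat \<Rightarrow> nat \<Rightarrow> (nat \<Rightarrow> 'm) \<Rightarrow> real ^ 'm::finite \<Rightarrow> real ^ 'm" where
  "J p q e P = (let mu = inverse (h p q e P + (zc p q e P)\<^sup>2)
     in mu *\<^sub>R hor p q e P + vert p q e (\<bar>mu\<bar> * zc p q e P))"


subsection \<open>The embedding and extensions along it\<close>

definition iota ::
  "nat \<Rightarrow> nat \<Rightarrow> (nat \<Rightarrow> 'm) \<Rightarrow> (nat \<Rightarrow> 'n) \<Rightarrow> real ^ 'm::finite \<Rightarrow> (real ^ 'n::finite) set" where
  "iota p q e c P = (let z = zc p q e P in
     orb (from_coords (p + q + 1) c (\<lambda>i.
       if i < p then P $ e i / z
       else if i = p then (1 - h p q e P - z\<^sup>2) / (2 * z)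
       else if i \<le> p + q then P $ e (i - 1) / z
       else (1 + h p q e P + z\<^sup>2) / (2 * z))))"

text \<open>
  The global isometries extending a partial map \<open>g\<close> of the half-space with domain \<open>D\<close>. For
  \<open>g \<in> G\<close> and for the inversion there is exactly one, an isometry of a connected
  pseudo-Riemannian manifold being determined by its values on a nonempty open set.
\<close>

definition extensions ::
  "nat \<Rightarrow> nat \<Rightarrow> (nat \<Rightarrow> 'm) \<Rightarrow> (nat \<Rightarrow> 'n) \<Rightarrow> (real ^ 'm::finite) set \<Rightarrow>
   (real ^ 'm \<Rightarrow> real ^ 'm) \<Rightarrow> ((real ^ 'n::finite) set \<Rightarrow> (real ^ 'n) set) set" where
  "extensions p q e c D g =
     {F \<in> Isom p q c. \<forall>P\<in>D. F (iota p q e c P) = iota p q e c (g P)}"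

end

theory Submission
  imports Defs
begin

text \<open>
  Write \<open>b\<close> for the form of signature \<open>(p, q + 1)\<close> and \<open>Q\<close> for the quadric \<open>b X X = -1\<close>. The proof
  identifies the isometries of \<open>Q / {\<plusminus>Id}\<close> with the linear isometries of \<open>b\<close> up to sign, and then
  generates the orthogonal group of \<open>b\<close> by a Bruhat decomposition.

  \<^emph>\<open>Isometries are linear.\<close> A local isometry \<open>\<Phi>\<close> of \<open>Q\<close> extends to the cone \<open>b X X < 0\<close> over \<open>Q\<close>, as
  the positively homogeneous map \<open>r Y \<mapsto> r \<Phi>(Y)\<close>. The flat metric on the cone is \<open>-dr\<^sup>2 + r\<^sup>2 g\<close>, where
  \<open>g\<close> is the metric of \<open>Q\<close>, so this extension is a local isometry of flat space. Such a map is
  affine: differentiating \<open>b (D\<^sub>u f) (D\<^sub>v f) = b u v\<close> shows that \<open>b (D\<^sub>w D\<^sub>u f) (D\<^sub>v f)\<close> is skew in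
  \<open>(u, v)\<close>, and it is symmetric in \<open>(u, w)\<close> because second derivatives commute; a trilinear expression
  with both symmetries vanishes. An affine homogeneous map is linear, so an isometry of the quotient
  is induced near each point by some element of the orthogonal group
  (\<open>pseudosphere_local_isometry_linear\<close>). Two linear maps inducing the same map on a nonempty open
  set agree up to sign, and up to sign every point of the cone lies in a subset of it that is
  star-shaped about a vector \<open>o\<close> with \<open>b o o = -1\<close>; so one linear map works everywhere
  (\<open>isometry_induced\<close>, \<open>Isom_eq_induced\<close>).

  \<^emph>\<open>Generation.\<close> Choose null vectors \<open>n\<close>, \<open>m\<close> with \<open>b n m = -2\<close>, orthogonal to the horizontal space
  \<open>\<real>\<^sup>p\<^sup>-\<^sup>1 \<oplus> \<real>\<^sup>q\<close>. The lift of \<open>\<iota>(x,y,z)\<close> is \<open>(1/z) (x,y) + (1/2z) m + ((h(x,y) + z\<^sup>2)/2z) n\<close>, and in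
  these coordinates the stabiliser of the line of \<open>n\<close> is, up to sign, the group of similarities
  \<open>G\<close> (\<open>stabilizer_extends_similarity\<close>), while the inversion is the reflection \<open>s\<close> exchanging \<open>n\<close> and
  \<open>m\<close> (\<open>swap_extends_inversion\<close>). Let \<open>B\<close> be any linear isometry. If \<open>b n (B n) \<noteq> 0\<close>, an Eichler
  transformation \<open>T\<close>, which fixes \<open>n\<close>, carries the null vector \<open>B n\<close> to a multiple of \<open>m\<close>; then
  \<open>s T B\<close> stabilises the line of \<open>n\<close>, so \<open>B\<close> is generated. The two remaining cases, \<open>b m (B n) \<noteq> 0\<close> and
  \<open>B n\<close> horizontal, reduce to this one by composing with \<open>s\<close> and with an Eichler transformation
  (\<open>orthogonal_generated\<close>).
\<close>

section \<open>Symmetry of second derivatives\<close>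

text \<open>
  The mean value theorem in the direction \<open>u\<close> turns the second difference into
  \<open>t (f' (x + \<theta>u + tw) u - f' (x + \<theta>u) u)\<close>, and the first-order expansion of \<open>f' \<cdot> u\<close> at \<open>x\<close> evaluates
  this bracket up to an error \<open>o(t)\<close>.
\<close>

lemma second_difference_quotient_tendsto:
  fixes f :: "'a::real_normed_vector \<Rightarrow> real"
  assumes S: "open S" "x \<in> S"
    and f': "\<And>y. y \<in> S \<Longrightarrow> (f has_derivative f' y) (at y)"
    and L: "((\<lambda>y. f' y u) has_derivative L) (at x)"
  shows "((\<lambda>t. (f (x + t *\<^sub>R u + t *\<^sub>R w) - f (x + t *\<^sub>R u) - f (x + t *\<^sub>R w) + f x) / t\<^sup>2)
    \<longlongrightarrow> L w) (at_right 0)"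
proof (rule tendstoI)
  fix \<epsilon> :: real assume "\<epsilon> > 0"
  \<comment> \<open>\<open>t M\<close> bounds the sum of the lengths of the two increments, \<open>\<theta>u + tw\<close> and \<open>\<theta>u\<close>, at which
    the expansion of \<open>f' \<cdot> u\<close> is used; the summand \<open>1\<close> makes \<open>M\<close> positive.\<close>
  define M where "M = 2 * norm u + norm w + 1"
  have M: "M > 0" by (simp add: M_def add_nonneg_pos)
  define \<eta> where "\<eta> = \<epsilon> / (2 * M)"
  have \<eta>: "\<eta> > 0" using \<open>\<epsilon> > 0\<close> M by (simp add: \<eta>_def)
  obtain \<delta> where \<delta>: "\<delta> > 0"
    and Ld: "\<And>y. norm (y - x) < \<delta> \<Longrightarrow> norm (f' y u - f' x u - L (y - x)) \<le> \<eta> * norm (y - x)"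
    using L \<eta> unfolding has_derivative_at_alt by blast
  obtain r where r: "r > 0" "ball x r \<subseteq> S" using S openE by blast
  interpret L: bounded_linear L using L by (rule has_derivative_bounded_linear)
  define \<tau> where "\<tau> = min \<delta> r / M"
  have \<tau>: "\<tau> > 0" using \<delta> r M by (simp add: \<tau>_def)
  have main: "dist ((f (x + t *\<^sub>R u + t *\<^sub>R w) - f (x + t *\<^sub>R u) - f (x + t *\<^sub>R w) + f x) / t\<^sup>2) (L w) < \<epsilon>"
    if t: "0 < t" "t < \<tau>" for t
  proof -
    have tM: "t * M < min \<delta> r" using t M by (simp add: \<tau>_def field_simps)
    have near: "norm (s *\<^sub>R u + s' *\<^sub>R w) < min \<delta> r" if "0 \<le> s" "s \<le> t" "0 \<le> s'" "s' \<le> t" for s s'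
    proof -
      have "norm (s *\<^sub>R u + s' *\<^sub>R w) \<le> s * norm u + s' * norm w"
        using norm_triangle_ineq[of "s *\<^sub>R u" "s' *\<^sub>R w"] that by simp
      also have "\<dots> \<le> t * norm u + t * norm w"
        using that by (intro add_mono mult_right_mono) auto
      also have "\<dots> \<le> t * M" using t by (simp add: M_def algebra_simps)
      finally show ?thesis using tM by simp
    qed
    have inS: "x + s *\<^sub>R u + s' *\<^sub>R w \<in> S" if "0 \<le> s" "s \<le> t" "0 \<le> s'" "s' \<le> t" for s s'
    proof -
      have "dist x (x + s *\<^sub>R u + s' *\<^sub>R w) = norm (s *\<^sub>R u + s' *\<^sub>R w)"
        by (metis add.assoc add_diff_cancel_left' dist_commute dist_norm)
      then have "dist x (x + s *\<^sub>R u + s' *\<^sub>R w) < r" using near[OF that] by simp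
      then show ?thesis using r by auto
    qed
    define \<phi> where "\<phi> s = f (x + s *\<^sub>R u + t *\<^sub>R w) - f (x + s *\<^sub>R u)" for s
    have d\<phi>: "(\<phi> has_real_derivative (f' (x + s *\<^sub>R u + t *\<^sub>R w) u - f' (x + s *\<^sub>R u) u)) (at s)"
      if "0 \<le> s" "s \<le> t" for s
    proof -
      have S1: "x + s *\<^sub>R u + t *\<^sub>R w \<in> S" using inS[of s t] that t by simp
      have S2: "x + s *\<^sub>R u \<in> S" using inS[of s 0] that t by simp
      have line: "((\<lambda>s. x + s *\<^sub>R u) has_derivative (\<lambda>k. k *\<^sub>R u)) (at s)"
        "((\<lambda>s. x + s *\<^sub>R u + t *\<^sub>R w) has_derivative (\<lambda>k. k *\<^sub>R u)) (at s)"
        by (auto intro!: derivative_eq_intros)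
      have d: "(\<phi> has_derivative (\<lambda>k. f' (x + s *\<^sub>R u + t *\<^sub>R w) (k *\<^sub>R u) - f' (x + s *\<^sub>R u) (k *\<^sub>R u))) (at s)"
        unfolding \<phi>_def
        using diff_chain_at[OF line(2) f'[OF S1]] diff_chain_at[OF line(1) f'[OF S2]]
        by (auto simp: o_def intro!: has_derivative_diff)
      have lin: "linear (f' (x + s *\<^sub>R u + t *\<^sub>R w))" "linear (f' (x + s *\<^sub>R u))"
        using f'[OF S1] f'[OF S2] has_derivative_linear by blast+
      have eq: "(\<lambda>k. f' (x + s *\<^sub>R u + t *\<^sub>R w) (k *\<^sub>R u) - f' (x + s *\<^sub>R u) (k *\<^sub>R u))
          = (*) (f' (x + s *\<^sub>R u + t *\<^sub>R w) u - f' (x + s *\<^sub>R u) u)"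
        by (simp only: fun_eq_iff linear_cmul[OF lin(1)] linear_cmul[OF lin(2)])
          (simp add: algebra_simps)
      show ?thesis
        using d unfolding has_field_derivative_def eq .
    qed
    obtain \<theta> where \<theta>: "0 < \<theta>" "\<theta> < t"
      and mvt: "\<phi> t - \<phi> 0 = (t - 0) * (f' (x + \<theta> *\<^sub>R u + t *\<^sub>R w) u - f' (x + \<theta> *\<^sub>R u) u)"
      using MVT2[OF t(1) d\<phi>] by blast
    let ?a = "\<theta> *\<^sub>R u + t *\<^sub>R w" and ?b = "\<theta> *\<^sub>R u"
    have E1: "norm (f' (x + ?a) u - f' x u - L ?a) \<le> \<eta> * norm ?a"
      using Ld[of "x + ?a"] near[of \<theta> t] \<theta> by simp
    have E2: "norm (f' (x + ?b) u - f' x u - L ?b) \<le> \<eta> * norm ?b"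
      using Ld[of "x + ?b"] near[of \<theta> 0] \<theta> t by simp
    have Lab: "L ?a - L ?b = t * L w" by (simp add: L.add L.scaleR)
    have "\<bar>(f' (x + ?a) u - f' (x + ?b) u) - t * L w\<bar> \<le> \<eta> * (norm ?a + norm ?b)"
      using E1 E2 Lab by (simp add: distrib_left abs_le_iff)
    also have "\<dots> \<le> \<eta> * (t * M)"
    proof (intro mult_left_mono)
      have "norm ?a + norm ?b \<le> (\<theta> * norm u + t * norm w) + \<theta> * norm u"
        using norm_triangle_ineq[of "\<theta> *\<^sub>R u" "t *\<^sub>R w"] \<theta> t by simp
      also have "\<dots> \<le> (t * norm u + t * norm w) + t * norm u"
        using \<theta> by (intro add_mono mult_right_mono) auto
      also have "\<dots> \<le> t * M" using t by (simp add: M_def algebra_simps)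
      finally show "norm ?a + norm ?b \<le> t * M" .
    qed (use \<eta> in simp)
    also have "\<dots> = \<epsilon> / 2 * t" using M by (simp add: \<eta>_def)
    finally have bound: "\<bar>(f' (x + ?a) u - f' (x + ?b) u) - t * L w\<bar> \<le> \<epsilon> / 2 * t" .
    have \<Delta>: "f (x + t *\<^sub>R u + t *\<^sub>R w) - f (x + t *\<^sub>R u) - f (x + t *\<^sub>R w) + f x
       = t * (f' (x + ?a) u - f' (x + ?b) u)"
      using mvt by (simp add: \<phi>_def add.assoc)
    have "(f (x + t *\<^sub>R u + t *\<^sub>R w) - f (x + t *\<^sub>R u) - f (x + t *\<^sub>R w) + f x) / t\<^sup>2 - L w
       = ((f' (x + ?a) u - f' (x + ?b) u) - t * L w) / t"
      unfolding \<Delta> using t(1) by (simp add: field_simps power2_eq_square)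
    also have "\<bar>\<dots>\<bar> \<le> \<epsilon> / 2" using bound t(1) by (simp add: abs_divide pos_divide_le_eq)
    finally show ?thesis using \<open>\<epsilon> > 0\<close> by (simp add: dist_real_def)
  qed
  show "\<forall>\<^sub>F t in at_right 0. dist ((f (x + t *\<^sub>R u + t *\<^sub>R w) - f (x + t *\<^sub>R u) - f (x + t *\<^sub>R w) + f x) / t\<^sup>2) (L w) < \<epsilon>"
    by (rule eventually_mono[OF eventually_at_right_real[OF \<tau>]]) (use main in auto)
qed

text \<open>
  Young's theorem: the second difference is symmetric in \<open>u\<close> and \<open>w\<close>, hence so is its limit.
\<close>

lemma second_derivative_symmetric:
  fixes f :: "'a::real_normed_vector \<Rightarrow> 'b::euclidean_space"
  assumes S: "open S" "x \<in> S"
    and f': "\<And>y. y \<in> S \<Longrightarrow> (f has_derivative f' y) (at y)"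
    and L: "((\<lambda>y. f' y u) has_derivative L) (at x)"
    and K: "((\<lambda>y. f' y w) has_derivative K) (at x)"
  shows "L w = K u"
proof (rule euclidean_eqI)
  fix i :: 'b assume "i \<in> Basis"
  have f'i: "((\<lambda>y. f y \<bullet> i) has_derivative (\<lambda>v. f' y v \<bullet> i)) (at y)" if "y \<in> S" for y
    using f'[OF that] by (rule has_derivative_inner_left)
  note quotient = second_difference_quotient_tendsto[OF S f'i]
  have "((\<lambda>t. (f (x + t *\<^sub>R u + t *\<^sub>R w) \<bullet> i - f (x + t *\<^sub>R u) \<bullet> i - f (x + t *\<^sub>R w) \<bullet> i + f x \<bullet> i) / t\<^sup>2)
      \<longlongrightarrow> L w \<bullet> i) (at_right 0)"
    using quotient[OF _ has_derivative_inner_left[OF L]] .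
  moreover have "((\<lambda>t. (f (x + t *\<^sub>R u + t *\<^sub>R w) \<bullet> i - f (x + t *\<^sub>R u) \<bullet> i - f (x + t *\<^sub>R w) \<bullet> i + f x \<bullet> i) / t\<^sup>2)
      \<longlongrightarrow> K u \<bullet> i) (at_right 0)"
    using quotient[OF _ has_derivative_inner_left[OF K], of u] by (simp add: algebra_simps)
  ultimately show "L w \<bullet> i = K u \<bullet> i"
    by (rule tendsto_unique[OF trivial_limit_at_right_real])
qed

section \<open>Isometries of open subsets of a pseudo-Euclidean space\<close>

locale pseudo_euclidean =
  fixes b :: "'a::euclidean_space \<Rightarrow> 'a \<Rightarrow> real"
  assumes bilin: "bilinear b"
    and sym: "b u v = b v u"
    and nondeg: "(\<And>v. b u v = 0) \<Longrightarrow> u = 0"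
begin

lemmas b_simps =
  bilinear_ladd[OF bilin] bilinear_radd[OF bilin] bilinear_lsub[OF bilin] bilinear_rsub[OF bilin]
  bilinear_lmul[OF bilin] bilinear_rmul[OF bilin] bilinear_lneg[OF bilin] bilinear_rneg[OF bilin]
  bilinear_lzero[OF bilin] bilinear_rzero[OF bilin]

sublocale bounded_bilinear b
  using bilin by (simp add: bilinear_conv_bounded_bilinear)

definition orthogonal_group :: "('a \<Rightarrow> 'a) set" where
  "orthogonal_group = {A. linear A \<and> (\<forall>u v. b (A u) (A v) = b u v)}"

lemma b_preserving_eq_0:
  assumes "\<And>u v. b (A u) (A v) = b u v" "A u = 0"
  shows "u = 0"
proof (rule nondeg)
  show "b u v = 0" for v using assms(1)[of u v] assms(2) by (simp add: b_simps)
qed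

text \<open>
  Nondegeneracy makes \<open>A\<close> injective, and the space is finite-dimensional.
\<close>

lemma b_preserving_surj:
  assumes "linear A" "\<And>u v. b (A u) (A v) = b u v"
  shows "surj A"
proof -
  have "A u = 0 \<Longrightarrow> u = 0" for u
    using b_preserving_eq_0 assms(2) by blast
  then have "inj A" using assms(1) by (simp add: linear_injective_0)
  then show ?thesis using assms(1) linear_injective_imp_surjective by blast
qed

text \<open>
  The Christoffel-symbol argument: the trilinear expression \<open>T w u v = b (D\<^sub>w D\<^sub>u f) (D\<^sub>v f)\<close> is symmetric
  in its first two arguments and skew in its last two, and the six transpositions taking \<open>T w u v\<close>
  back to itself produce an odd number of signs.
\<close>

lemma flat_isometry_derivative_locally_constant:
  assumes S: "open S"
    and f': "\<And>y. y \<in> S \<Longrightarrow> (f has_derivative f' y) (at y)"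
    and f'': "\<And>y u. y \<in> S \<Longrightarrow> (\<lambda>y. f' y u) differentiable (at y)"
    and iso: "\<And>y u v. y \<in> S \<Longrightarrow> b (f' y u) (f' y v) = b u v"
    and y: "y \<in> S"
  shows "((\<lambda>y. f' y u) has_derivative (\<lambda>_. 0)) (at y)"
proof -
  define D where "D u = frechet_derivative (\<lambda>y. f' y u) (at y)" for u
  have D: "((\<lambda>y. f' y u) has_derivative D u) (at y)" for u
    using f''[OF y] unfolding D_def frechet_derivative_works .
  have D_sym: "D u w = D w u" for u w
    using second_derivative_symmetric[OF S y f' D D] .
  define T where "T w u v = b (D u w) (f' y v)" for w u v
  have T_sym: "T w u v = T u w v" for w u v
    by (simp add: T_def D_sym)
  have T_skew: "T w u v = - T w v u" for w u v
  proof -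
    have "((\<lambda>z. b (f' z u) (f' z v)) has_derivative (\<lambda>w. b (f' y u) (D v w) + b (D u w) (f' y v))) (at y)"
      by (rule FDERIV[OF D D])
    moreover have "((\<lambda>z. b (f' z u) (f' z v)) has_derivative (\<lambda>_. 0)) (at y)"
      by (rule has_derivative_transform_within_open[OF has_derivative_const[of "b u v"] S y])
        (simp add: iso)
    ultimately have "(\<lambda>w. b (f' y u) (D v w) + b (D u w) (f' y v)) = (\<lambda>_. 0)"
      by (rule has_derivative_unique)
    then have "b (f' y u) (D v w) + b (D u w) (f' y v) = 0" by (rule fun_cong)
    then show ?thesis unfolding T_def by (simp add: sym[of "f' y u"])
  qed
  have T_0: "T w u v = 0" for w u v
  proof -
    have "T w u v = - T w v u" by (rule T_skew)
    also have "\<dots> = - T v w u" by (simp add: T_sym)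
    also have "\<dots> = T v u w" by (simp add: T_skew[of v w])
    also have "\<dots> = T u v w" by (rule T_sym)
    also have "\<dots> = - T u w v" by (rule T_skew)
    also have "\<dots> = - T w u v" by (simp add: T_sym)
    finally show ?thesis by simp
  qed
  have "surj (f' y)"
    using b_preserving_surj f'[OF y] iso[OF y] has_derivative_linear by blast
  then have "D u w = 0" for w
    using T_0 unfolding T_def by (intro nondeg) (metis surjD)
  then show ?thesis using D[of u] by presburger
qed

lemma flat_isometry_locally_affine:
  assumes S: "open S"
    and f': "\<And>y. y \<in> S \<Longrightarrow> (f has_derivative f' y) (at y)"
    and f'': "\<And>y u. y \<in> S \<Longrightarrow> (\<lambda>y. f' y u) differentiable (at y)"
    and iso: "\<And>y u v. y \<in> S \<Longrightarrow> b (f' y u) (f' y v) = b u v"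
    and x: "x \<in> S"
  shows "\<exists>r>0. ball x r \<subseteq> S \<and> (\<forall>y\<in>ball x r. f' y = f' x)"
proof -
  obtain r where r: "r > 0" "ball x r \<subseteq> S" using S x openE by blast
  have "f' y = f' x" if "y \<in> ball x r" for y
  proof
    fix u
    have "((\<lambda>z. f' z u) has_derivative (\<lambda>_. 0)) (at z within ball x r)" if "z \<in> ball x r" for z
      using flat_isometry_derivative_locally_constant[OF S f' f'' iso] that r
      by (meson has_derivative_at_withinI subsetD)
    then show "f' y u = f' x u"
      by (rule has_derivative_zero_unique[OF convex_ball]) (use that r in auto)
  qed
  then show ?thesis using r by blast
qed

end

section \<open>Local isometries of the unit pseudosphere are linear\<close>

text \<open>
  Two lifts of one map to a double covering by sign differ by a locally constant sign: where the
  wrong sign holds, \<open>g - s f\<close> has norm \<open>2 |f|\<close>, which is impossible near a point at which \<open>g - s f\<close>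
  vanishes and \<open>f\<close> does not. The predicate \<open>P\<close> confines the comparison to a subset, such as a
  hypersurface, containing \<open>x\<close>.
\<close>

lemma eventually_same_sign:
  fixes f g :: "'a::metric_space \<Rightarrow> 'b::real_normed_vector"
  assumes f: "continuous (at x) f" and g: "continuous (at x) g"
    and nz: "f x \<noteq> 0"
    and pm: "\<forall>\<^sub>F y in nhds x. P y \<longrightarrow> g y = f y \<or> g y = - f y" and x: "P x"
  obtains s where "s = 1 \<or> s = -1" "\<forall>\<^sub>F y in nhds x. P y \<longrightarrow> g y = s *\<^sub>R f y"
proof -
  have "g x = f x \<or> g x = - f x" using eventually_nhds_x_imp_x[OF pm] x by blast
  then obtain s :: real where s: "s = 1 \<or> s = -1" "g x = s *\<^sub>R f x"
    by (metis scaleR_minus1_left scaleR_one)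
  define F where "F y = norm (f y) - norm (g y - s *\<^sub>R f y)" for y
  have "continuous (at x) F"
    unfolding F_def by (intro continuous_intros f g)
  then have "(F \<longlongrightarrow> F x) (nhds x)"
    unfolding isCont_def tendsto_at_iff_tendsto_nhds .
  moreover have "F x > 0" using s nz by (simp add: F_def)
  ultimately have "\<forall>\<^sub>F y in nhds x. F y > 0"
    by (rule order_tendstoD)
  with pm have "\<forall>\<^sub>F y in nhds x. P y \<longrightarrow> g y = s *\<^sub>R f y"
  proof eventually_elim
    case (elim y)
    have "f y + f y = 2 *\<^sub>R f y" "- f y - f y = - (2 *\<^sub>R f y)" by (simp_all add: scaleR_2)
    then have "norm (f y + f y) = 2 * norm (f y)" "norm (- f y - f y) = 2 * norm (f y)" by simp_all
    then show ?case using elim s(1) by (auto simp: F_def)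
  qed
  then show ?thesis using that s by blast
qed

context pseudo_euclidean
begin

definition pseudosphere :: "'a set" where
  "pseudosphere = {X. b X X = -1}"

definition negative_cone :: "'a set" where
  "negative_cone = {X. b X X < 0}"

definition radius :: "'a \<Rightarrow> real" where
  "radius X = sqrt (- b X X)"

definition unit :: "'a \<Rightarrow> 'a" where
  "unit X = X /\<^sub>R radius X"

text \<open>
  The extension by homogeneity of a map of the pseudosphere to the cone over it.
\<close>

definition cone_ext :: "('a \<Rightarrow> 'a) \<Rightarrow> 'a \<Rightarrow> 'a" where
  "cone_ext \<Phi> X = radius X *\<^sub>R \<Phi> (unit X)"

text \<open>
  Split \<open>w\<close> along \<open>Y = unit X\<close> as \<open>\<alpha> Y + v\<close> with \<open>b Y v = 0\<close>, so that \<open>\<alpha> = - b Y w\<close>. The derivative of a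
  homogeneous extension sends the radial part \<open>\<alpha> Y\<close> to \<open>\<alpha> \<Phi> Y\<close> and the tangential part \<open>v\<close> to \<open>\<Phi>' v\<close>.
\<close>

definition cone_ext_deriv :: "('a \<Rightarrow> 'a) \<Rightarrow> ('a \<Rightarrow> 'a) \<Rightarrow> 'a \<Rightarrow> 'a \<Rightarrow> 'a" where
  "cone_ext_deriv \<Phi> \<Phi>' X w =
     (- b (unit X) w) *\<^sub>R \<Phi> (unit X) + \<Phi>' (w + b (unit X) w *\<^sub>R unit X)"

lemma open_negative_cone: "open negative_cone"
  unfolding negative_cone_def
  by (rule open_Collect_less[OF continuous_on continuous_on_const]) (rule continuous_on_id)+

lemma pseudosphere_subset: "pseudosphere \<subseteq> negative_cone"
  by (auto simp: pseudosphere_def negative_cone_def)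

lemma radius_pos: "X \<in> negative_cone \<Longrightarrow> radius X > 0"
  by (simp add: radius_def negative_cone_def)

lemma radius_square: "X \<in> negative_cone \<Longrightarrow> (radius X)\<^sup>2 = - b X X"
  by (simp add: radius_def negative_cone_def)

lemma unit_in_pseudosphere: "X \<in> negative_cone \<Longrightarrow> unit X \<in> pseudosphere"
  using radius_pos[of X] radius_square[of X]
  by (simp add: unit_def pseudosphere_def b_simps divide_simps power2_eq_square negative_cone_def)

lemma radius_unit_pseudosphere:
  assumes "X \<in> pseudosphere" shows "radius X = 1" "unit X = X"
  using assms by (simp_all add: pseudosphere_def radius_def unit_def)

lemma radius_has_derivative:
  assumes "X \<in> negative_cone"
  shows "(radius has_derivative (\<lambda>w. - b (unit X) w)) (at X)"
proof -
  have "((\<lambda>X. - b X X) has_derivative (\<lambda>w. - (b X w + b w X))) (at X)"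
    by (intro has_derivative_minus FDERIV has_derivative_ident)
  from has_derivative_real_sqrt[OF _ this] assms
  have "(radius has_derivative (\<lambda>w. - (b X w + b w X) / (2 * sqrt (- b X X)))) (at X)"
    unfolding radius_def[abs_def] negative_cone_def
    by (simp add: field_simps)
  moreover have "- (b X w + b w X) / (2 * sqrt (- b X X)) = - b (unit X) w" for w
    using radius_pos[OF assms] unfolding radius_def[symmetric] unit_def
    by (simp add: b_simps sym[of w] field_simps)
  ultimately show ?thesis by simp
qed

lemma unit_has_derivative:
  assumes "X \<in> negative_cone"
  shows "(unit has_derivative (\<lambda>w. (w + b (unit X) w *\<^sub>R unit X) /\<^sub>R radius X)) (at X)"
proof -
  have r: "radius X \<noteq> 0" using radius_pos[OF assms] by simp
  have "(unit has_derivative (\<lambda>w. inverse (radius X) *\<^sub>R w +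
      (- (inverse (radius X) * - b (unit X) w * inverse (radius X))) *\<^sub>R X)) (at X)"
    unfolding unit_def[abs_def]
    using has_derivative_scaleR[OF Deriv.has_derivative_inverse[where f=radius, OF r radius_has_derivative[OF assms]]
        has_derivative_ident]
    by (simp only: unit_def)
  then show ?thesis by (simp add: unit_def scaleR_add_right algebra_simps)
qed

lemma continuous_unit: "X \<in> negative_cone \<Longrightarrow> continuous (at X) unit"
  using unit_has_derivative has_derivative_continuous by blast

lemma open_unit_vimage:
  assumes "open U" shows "open {X \<in> negative_cone. unit X \<in> U}"
proof -
  have "continuous_on negative_cone unit"
    using continuous_unit continuous_at_imp_continuous_on by blast
  then have "open (unit -` U \<inter> negative_cone)"
    using open_negative_cone assms by (simp add: continuous_on_open_vimage)
  then show ?thesis by (simp add: vimage_def Int_def conj_commute)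
qed

lemma cone_ext_has_derivative:
  assumes X: "X \<in> negative_cone" and \<Phi>: "(\<Phi> has_derivative \<Phi>') (at (unit X))"
  shows "(cone_ext \<Phi> has_derivative cone_ext_deriv \<Phi> \<Phi>' X) (at X)"
proof -
  have r: "radius X \<noteq> 0" using radius_pos[OF X] by simp
  have lin: "linear \<Phi>'" using \<Phi> by (rule has_derivative_linear)
  have "((\<lambda>X. \<Phi> (unit X)) has_derivative (\<lambda>w. \<Phi>' ((w + b (unit X) w *\<^sub>R unit X) /\<^sub>R radius X))) (at X)"
    using diff_chain_at[OF unit_has_derivative[OF X] \<Phi>] by (simp add: o_def)
  from has_derivative_scaleR[OF radius_has_derivative[OF X] this]
  have "(cone_ext \<Phi> has_derivative (\<lambda>w. radius X *\<^sub>R \<Phi>' ((w + b (unit X) w *\<^sub>R unit X) /\<^sub>R radius X)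
      + (- b (unit X) w) *\<^sub>R \<Phi> (unit X))) (at X)"
    unfolding cone_ext_def[abs_def] .
  then show ?thesis
    using r by (simp add: linear_cmul[OF lin] cone_ext_deriv_def[abs_def] add.commute)
qed

text \<open>
  Maps that agree on the pseudosphere have the same homogeneous extension, and the derivative of that
  extension restricts to the given derivatives on tangent vectors. Passing to the cone replaces a
  differentiation along the hypersurface by one on an open set.
\<close>

lemma tangential_derivative_unique:
  fixes \<Phi> \<Psi> :: "'a \<Rightarrow> 'a"
  assumes Y: "Y \<in> pseudosphere" and v: "b Y v = 0"
    and \<Phi>: "(\<Phi> has_derivative \<Phi>') (at Y)" and \<Psi>: "(\<Psi> has_derivative \<Psi>') (at Y)"
    and eq: "\<forall>\<^sub>F Z in nhds Y. Z \<in> pseudosphere \<longrightarrow> \<Psi> Z = \<Phi> Z"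
  shows "\<Psi>' v = \<Phi>' v"
proof -
  have YN: "Y \<in> negative_cone" and uY: "unit Y = Y"
    using Y pseudosphere_subset radius_unit_pseudosphere by auto
  obtain W where W: "open W" "Y \<in> W" "\<And>Z. Z \<in> W \<Longrightarrow> Z \<in> pseudosphere \<Longrightarrow> \<Psi> Z = \<Phi> Z"
    using eq unfolding eventually_nhds by blast
  let ?V = "{X \<in> negative_cone. unit X \<in> W}"
  have "cone_ext \<Phi> X = cone_ext \<Psi> X" if "X \<in> ?V" for X
    using that W(3) unit_in_pseudosphere unfolding cone_ext_def by auto
  then have D: "(cone_ext \<Psi> has_derivative cone_ext_deriv \<Phi> \<Phi>' Y) (at Y)"
    using has_derivative_transform_within_open[OF cone_ext_has_derivative[OF YN] open_unit_vimage[OF W(1)]]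
      \<Phi> YN uY W(2) by auto
  have "(cone_ext \<Psi> has_derivative cone_ext_deriv \<Psi> \<Psi>' Y) (at Y)"
    using cone_ext_has_derivative[OF YN] \<Psi> uY by simp
  from fun_cong[OF has_derivative_unique[OF D this], of v] show ?thesis using v by (simp add: cone_ext_deriv_def uY)
qed

text \<open>
  The extension \<open>f\<close> satisfies \<open>b (f X) (f X) = b X X\<close> on an open set, because \<open>\<Phi>\<close> maps into the
  pseudosphere; differentiate in a tangent direction.
\<close>

lemma derivative_tangential:
  assumes U: "open U" "Y \<in> U" and Y: "Y \<in> pseudosphere" and v: "b Y v = 0"
    and maps: "\<And>Z. Z \<in> U \<Longrightarrow> Z \<in> pseudosphere \<Longrightarrow> \<Phi> Z \<in> pseudosphere"
    and \<Phi>: "(\<Phi> has_derivative \<Phi>') (at Y)"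
  shows "b (\<Phi> Y) (\<Phi>' v) = 0"
proof -
  have YN: "Y \<in> negative_cone" and uY: "unit Y = Y" "radius Y = 1"
    using Y pseudosphere_subset radius_unit_pseudosphere by auto
  let ?V = "{X \<in> negative_cone. unit X \<in> U}"
  have D: "(cone_ext \<Phi> has_derivative cone_ext_deriv \<Phi> \<Phi>' Y) (at Y)"
    using cone_ext_has_derivative[OF YN] \<Phi> uY by simp
  have "b (cone_ext \<Phi> X) (cone_ext \<Phi> X) = b X X" if "X \<in> ?V" for X
    using that maps[of "unit X"] unit_in_pseudosphere[of X] radius_square[of X]
    by (auto simp: cone_ext_def b_simps pseudosphere_def power2_eq_square)
  then have D1: "((\<lambda>X. b X X) has_derivative
      (\<lambda>w. b (cone_ext \<Phi> Y) (cone_ext_deriv \<Phi> \<Phi>' Y w) + b (cone_ext_deriv \<Phi> \<Phi>' Y w) (cone_ext \<Phi> Y))) (at Y)"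
    using has_derivative_transform_within_open[OF FDERIV[OF D D] open_unit_vimage[OF U(1)]] YN uY U(2)
    by auto
  have D2: "((\<lambda>X. b X X) has_derivative (\<lambda>w. b Y w + b w Y)) (at Y)"
    by (rule FDERIV[OF has_derivative_ident has_derivative_ident])
  from fun_cong[OF has_derivative_unique[OF D1 D2], of v] show ?thesis
    using v uY by (simp add: cone_ext_def cone_ext_deriv_def sym[of v Y] sym[of "\<Phi>' v" "\<Phi> Y"])
qed

text \<open>
  The splitting into radial and tangential parts is orthogonal before and after applying the
  derivative, and each part is preserved.
\<close>

lemma cone_ext_deriv_isometric:
  assumes X: "X \<in> negative_cone" and \<Phi>X: "\<Phi> (unit X) \<in> pseudosphere"
    and lin: "linear \<Phi>'"
    and orth: "\<And>v. b (unit X) v = 0 \<Longrightarrow> b (\<Phi> (unit X)) (\<Phi>' v) = 0"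
    and iso: "\<And>v w. b (unit X) v = 0 \<Longrightarrow> b (unit X) w = 0 \<Longrightarrow> b (\<Phi>' v) (\<Phi>' w) = b v w"
  shows "b (cone_ext_deriv \<Phi> \<Phi>' X v) (cone_ext_deriv \<Phi> \<Phi>' X w) = b v w"
proof -
  define Y where "Y = unit X"
  have Y: "b Y Y = -1" using unit_in_pseudosphere[OF X] by (simp add: Y_def pseudosphere_def)
  have FY: "b (\<Phi> Y) (\<Phi> Y) = -1" using \<Phi>X by (simp add: Y_def pseudosphere_def)
  \<comment> \<open>The orthogonal projection to the tangent space at \<open>Y\<close>.\<close>
  define P where "P w = w + b Y w *\<^sub>R Y" for w
  have P: "b Y (P w) = 0" for w by (simp add: P_def b_simps Y)
  have PP: "b (P v) (P w) = b v w + b Y v * b Y w"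
    by (simp add: P_def b_simps Y sym[of v Y])
  have "b (cone_ext_deriv \<Phi> \<Phi>' X v) (cone_ext_deriv \<Phi> \<Phi>' X w)
     = - (b Y v * b Y w) + b (\<Phi>' (P v)) (\<Phi>' (P w))"
    using orth[folded Y_def, OF P] sym[of "\<Phi>' (P v)" "\<Phi> Y"]
    by (simp add: cone_ext_deriv_def b_simps FY flip: Y_def P_def)
  also have "\<dots> = b v w" using iso[folded Y_def, OF P P] PP by simp
  finally show ?thesis .
qed

text \<open>
  This makes the extension twice differentiable, as the argument for flat isometries requires. In the
  formula for its derivative the argument of \<open>\<Phi>' (unit X)\<close> depends on \<open>X\<close> as well; expanding it in a
  basis leaves only derivatives of \<open>\<Phi>\<close> in fixed directions, which are differentiable by hypothesis.
\<close>

lemma cone_ext_deriv_differentiable: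
  assumes U: "open U"
    and \<Phi>': "\<And>Y. Y \<in> U \<Longrightarrow> (\<Phi> has_derivative \<Phi>' Y) (at Y)"
    and \<Phi>'': "\<And>Y v. Y \<in> U \<Longrightarrow> (\<lambda>Y. \<Phi>' Y v) differentiable (at Y)"
    and X: "X \<in> negative_cone" "unit X \<in> U"
  shows "(\<lambda>X. cone_ext_deriv \<Phi> (\<Phi>' (unit X)) X w) differentiable (at X)"
proof -
  let ?V = "{X \<in> negative_cone. unit X \<in> U}"
  have expand: "\<Phi>' Y u = (\<Sum>i\<in>Basis. (u \<bullet> i) *\<^sub>R \<Phi>' Y i)" if "Y \<in> U" for Y u
  proof -
    have lin: "linear (\<Phi>' Y)" using \<Phi>'[OF that] by (rule has_derivative_linear)
    have "\<Phi>' Y u = \<Phi>' Y (\<Sum>i\<in>Basis. (u \<bullet> i) *\<^sub>R i)" by (simp add: euclidean_representation)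
    then show ?thesis by (simp only: linear_sum[OF lin] linear_cmul[OF lin])
  qed
  have du: "unit differentiable (at X)"
    using unit_has_derivative[OF X(1)] by (auto simp: differentiable_def)
  have db: "(\<lambda>X. b (unit X) w) differentiable (at X)"
    using FDERIV[OF unit_has_derivative[OF X(1)] has_derivative_const] by (auto simp: differentiable_def)
  have comp: "(\<lambda>X. f (unit X)) differentiable (at X)" if "f differentiable (at (unit X))" for f :: "'a \<Rightarrow> 'a"
    using differentiable_chain_at[OF du that] by (simp add: o_def)
  have d\<Phi>: "\<Phi> differentiable (at (unit X))"
    using \<Phi>'[OF X(2)] by (auto simp: differentiable_def)
  have di: "(\<lambda>X. f X \<bullet> i) differentiable (at X)" if "f differentiable (at X)" for f :: "'a \<Rightarrow> 'a" and i
    using that has_derivative_inner_left unfolding differentiable_def by blast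
  have "(\<lambda>X. (- b (unit X) w) *\<^sub>R \<Phi> (unit X)
      + (\<Sum>i\<in>Basis. ((w + b (unit X) w *\<^sub>R unit X) \<bullet> i) *\<^sub>R \<Phi>' (unit X) i)) differentiable (at X)"
    by (intro differentiable_add differentiable_scaleR differentiable_minus differentiable_sum
        finite_Basis ballI db comp d\<Phi> \<Phi>'' X di differentiable_const du)
  then obtain D where D: "((\<lambda>X. (- b (unit X) w) *\<^sub>R \<Phi> (unit X)
      + (\<Sum>i\<in>Basis. ((w + b (unit X) w *\<^sub>R unit X) \<bullet> i) *\<^sub>R \<Phi>' (unit X) i)) has_derivative D) (at X)"
    unfolding differentiable_def by blast
  have "((\<lambda>X. cone_ext_deriv \<Phi> (\<Phi>' (unit X)) X w) has_derivative D) (at X)"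
    by (rule has_derivative_transform_within_open[OF D open_unit_vimage[OF U]])
      (use X in \<open>auto simp: cone_ext_deriv_def expand[symmetric]\<close>)
  then show ?thesis by (auto simp: differentiable_def)
qed

text \<open>
  The homogeneous extension is a flat isometry, so its derivative is a constant linear isometry \<open>A\<close> near
  \<open>X\<close>. By Euler's identity a homogeneous map satisfies \<open>f Y = f' Y Y\<close>, hence equals \<open>A\<close> there.
\<close>

theorem pseudosphere_local_isometry_linear:
  assumes U: "open U" "X \<in> U" and X: "X \<in> pseudosphere"
    and \<Phi>': "\<And>Y. Y \<in> U \<Longrightarrow> (\<Phi> has_derivative \<Phi>' Y) (at Y)"
    and \<Phi>'': "\<And>Y v. Y \<in> U \<Longrightarrow> (\<lambda>Y. \<Phi>' Y v) differentiable (at Y)"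
    and maps: "\<And>Y. Y \<in> U \<Longrightarrow> Y \<in> pseudosphere \<Longrightarrow> \<Phi> Y \<in> pseudosphere"
    and iso: "\<And>Y v w. Y \<in> U \<Longrightarrow> Y \<in> pseudosphere \<Longrightarrow> b Y v = 0 \<Longrightarrow> b Y w = 0 \<Longrightarrow>
      b (\<Phi>' Y v) (\<Phi>' Y w) = b v w"
  obtains A W where "A \<in> orthogonal_group" "open W" "X \<in> W"
    "\<And>Y. Y \<in> W \<Longrightarrow> Y \<in> pseudosphere \<Longrightarrow> \<Phi> Y = A Y"
proof -
  let ?V = "{X \<in> negative_cone. unit X \<in> U}"
  let ?D = "\<lambda>X. cone_ext_deriv \<Phi> (\<Phi>' (unit X)) X"
  have lin: "linear (\<Phi>' Y)" if "Y \<in> U" for Y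
    using \<Phi>'[OF that] by (rule has_derivative_linear)
  have V: "open ?V" using U(1) by (rule open_unit_vimage)
  have XV: "X \<in> ?V" using X U pseudosphere_subset radius_unit_pseudosphere by auto
  have D: "(cone_ext \<Phi> has_derivative ?D Z) (at Z)" if "Z \<in> ?V" for Z
    using that cone_ext_has_derivative \<Phi>' by blast
  have DD: "(\<lambda>Z. ?D Z w) differentiable (at Z)" if "Z \<in> ?V" for Z w
    by (rule cone_ext_deriv_differentiable[OF U(1) \<Phi>' \<Phi>'']) (use that in auto)
  have D_iso: "b (?D Z u) (?D Z v) = b u v" if "Z \<in> ?V" for Z u v
    using that unit_in_pseudosphere[of Z] maps lin iso
      derivative_tangential[OF U(1) _ _ _ maps \<Phi>']
    by (intro cone_ext_deriv_isometric) auto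
  obtain r where r: "r > 0" "ball X r \<subseteq> ?V" "\<And>Y. Y \<in> ball X r \<Longrightarrow> ?D Y = ?D X"
    using flat_isometry_locally_affine[OF V D DD D_iso XV] by blast
  have "?D X \<in> orthogonal_group"
    using D_iso[OF XV] has_derivative_linear[OF D[OF XV]] unfolding orthogonal_group_def by blast
  moreover have "\<Phi> Y = ?D X Y" if "Y \<in> ball X r" "Y \<in> pseudosphere" for Y
  proof -
    have "Y \<in> U" using that r(2) radius_unit_pseudosphere by auto
    then have "?D Y Y = \<Phi> Y"
      using that linear_0[OF lin] radius_unit_pseudosphere[OF that(2)]
      by (simp add: cone_ext_deriv_def pseudosphere_def)
    then show ?thesis using r(3)[OF that(1)] by simp
  qed
  ultimately show ?thesis using that[of "?D X" "ball X r"] r(1) by auto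
qed

end

section \<open>The isometry group of the quotient\<close>

lemma orb_eq_iff: "orb x = orb y \<longleftrightarrow> x = y \<or> x = - y"
  by (auto simp: orb_def doubleton_eq_iff)

lemma orb_uminus [simp]: "orb (- x) = orb x"
  by (simp add: orb_eq_iff)

lemma orb_eq_scaleR: "k \<noteq> 0 \<Longrightarrow> orb (k *\<^sub>R x) = orb (k *\<^sub>R y) \<longleftrightarrow> orb x = orb y"
  by (simp add: orb_eq_iff flip: scaleR_minus_right)

lemma image_orb: "linear A \<Longrightarrow> A ` orb X = orb (A X)"
  by (simp add: orb_def linear_neg)

lemma has_derivative_affine:
  fixes A :: "'a::euclidean_space \<Rightarrow> 'b::real_normed_vector"
  assumes "linear A"
  shows "((\<lambda>x. A x + t) has_derivative A) (at x)"
  using has_derivative_add[OF linear_imp_has_derivative[OF assms] has_derivative_const[of t]] by simp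

lemma Ck_on_constant:
  assumes "open U" "\<And>x. x \<in> U \<Longrightarrow> g x = v"
  shows "Ck_on k U g"
  using assms(2)
proof (induction k arbitrary: g v)
  case 0
  then show ?case using continuous_on_cong[of U U g "\<lambda>_. v"] by simp
next
  case (Suc k)
  have D: "(g has_derivative (\<lambda>_. 0)) (at x)" if "x \<in> U" for x
    by (rule has_derivative_transform_within_open[OF has_derivative_const[of v] assms(1) that])
      (simp add: Suc.prems)
  have "frechet_derivative g (at x) w = 0" if "x \<in> U" for x w
    using frechet_derivative_at[OF D[OF that]] by metis
  then show ?case using D Suc.IH by (auto simp: differentiable_def)
qed

lemma smooth_on_affine:
  fixes A :: "'a::euclidean_space \<Rightarrow> 'b::real_normed_vector"
  assumes "open U" "linear A" and eq: "\<And>x. x \<in> U \<Longrightarrow> f x = A x + t"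
  shows "smooth_on U f"
  unfolding smooth_on_def
proof
  fix k
  have D: "(f has_derivative A) (at x)" if "x \<in> U" for x
    by (rule has_derivative_transform_within_open[OF has_derivative_affine[OF assms(2)] assms(1) that])
      (simp add: eq)
  show "Ck_on k U f"
  proof (cases k)
    case 0
    have "continuous_on U f"
      using D has_derivative_continuous continuous_at_imp_continuous_on by blast
    then show ?thesis using 0 by simp
  next
    case (Suc j)
    have "frechet_derivative f (at x) v = A v" if "x \<in> U" for x v
      using frechet_derivative_at[OF D[OF that]] by metis
    then show ?thesis using Suc D by (auto simp: differentiable_def intro!: Ck_on_constant[OF assms(1)])
  qed
qed

lemma smooth_on_differentiable:
  assumes "smooth_on U f" "x \<in> U"
  shows "(f has_derivative frechet_derivative f (at x)) (at x)"
    "(\<lambda>x. frechet_derivative f (at x) v) differentiable (at x)"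
proof -
  have "Ck_on (Suc (Suc 0)) U f" using assms(1) unfolding smooth_on_def by blast
  then show "(f has_derivative frechet_derivative f (at x)) (at x)"
    "(\<lambda>x. frechet_derivative f (at x) v) differentiable (at x)"
    using assms(2) by (auto simp flip: frechet_derivative_works)
qed

lemma form_sym: "form r s c u v = form r s c v u"
  by (simp add: form_def mult.commute)

lemma bilinear_form: "bilinear (form r s c)"
proof -
  have "linear (form r s c u)" for u
  proof (rule linearI)
    show "form r s c u (v + w) = form r s c u v + form r s c u w" for v w
      by (simp add: form_def distrib_left sum.distrib)
    show "form r s c u (k *\<^sub>R v) = k *\<^sub>R form r s c u v" for k v
      by (simp add: form_def sum_distrib_left right_diff_distrib mult.left_commute)
  qed
  moreover from this have "linear (\<lambda>u. form r s c u v)" for v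
    by (simp only: form_sym[of r s c _ v])
  ultimately show ?thesis by (simp add: bilinear_def)
qed

locale half_space_model =
  fixes p q :: nat and e :: "nat \<Rightarrow> 'm::finite" and c :: "nat \<Rightarrow> 'n::finite"
  assumes p: "p \<ge> 1"
    and e: "bij_betw e {1..p + q} (UNIV :: 'm set)"
    and c: "bij_betw c {1..p + q + 1} (UNIV :: 'n set)"
begin

lemma c_eq_iff: "i \<in> {1..p + q + 1} \<Longrightarrow> j \<in> {1..p + q + 1} \<Longrightarrow> c i = c j \<longleftrightarrow> i = j"
  by (rule inj_on_eq_iff[OF bij_betw_imp_inj_on[OF c]])

lemma e_eq_iff: "i \<in> {1..p + q} \<Longrightarrow> j \<in> {1..p + q} \<Longrightarrow> e i = e j \<longleftrightarrow> i = j"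
  by (rule inj_on_eq_iff[OF bij_betw_imp_inj_on[OF e]])

lemma vec_eq_c: "(\<And>i. i \<in> {1..p + q + 1} \<Longrightarrow> u $ c i = v $ c i) \<Longrightarrow> u = v"
proof -
  assume *: "\<And>i. i \<in> {1..p + q + 1} \<Longrightarrow> u $ c i = v $ c i"
  have "u $ k = v $ k" for k
  proof -
    have "k \<in> c ` {1..p + q + 1}" using bij_betw_imp_surj_on[OF c] by simp
    then show ?thesis using * by blast
  qed
  then show ?thesis by (simp add: vec_eq_iff)
qed

lemma vec_eq_e: "(\<And>i. i \<in> {1..p + q} \<Longrightarrow> u $ e i = v $ e i) \<Longrightarrow> u = v"
proof -
  assume *: "\<And>i. i \<in> {1..p + q} \<Longrightarrow> u $ e i = v $ e i"
  have "u $ k = v $ k" for k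
  proof -
    have "k \<in> e ` {1..p + q}" using bij_betw_imp_surj_on[OF e] by simp
    then show ?thesis using * by blast
  qed
  then show ?thesis by (simp add: vec_eq_iff)
qed

definition ambient_form :: "real ^ 'n \<Rightarrow> real ^ 'n \<Rightarrow> real" where
  "ambient_form = form p (q + 1) c"

lemma form_axis:
  assumes j: "j \<in> {1..p + q + 1}"
  shows "ambient_form u (axis (c j) 1) = (if j \<le> p then u $ c j else - u $ c j)"
proof -
  have ax: "axis (c j) 1 $ c i = (if i = j then 1 else 0)" if "i \<in> {1..p + q + 1}" for i
    using c_eq_iff[OF that j] by (auto simp: axis_def)
  have 1: "(\<Sum>i=1..p. u $ c i * axis (c j) 1 $ c i) = (\<Sum>i=1..p. if i = j then u $ c j else 0)"
    by (intro sum.cong) (auto simp: ax)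
  have 2: "(\<Sum>i=p+1..p+(q+1). u $ c i * axis (c j) 1 $ c i)
      = (\<Sum>i=p+1..p+(q+1). if i = j then u $ c j else 0)"
    by (intro sum.cong) (auto simp: ax)
  show ?thesis using j unfolding ambient_form_def form_def 1 2 by (auto simp: sum.delta)
qed

sublocale pseudo_euclidean ambient_form
proof
  show "bilinear ambient_form" unfolding ambient_form_def by (rule bilinear_form)
  show "ambient_form u v = ambient_form v u" for u v unfolding ambient_form_def by (rule form_sym)
  show "u = 0" if "\<And>v. ambient_form u v = 0" for u
  proof (rule vec_eq_c)
    fix i assume i: "i \<in> {1..p + q + 1}"
    show "u $ c i = 0 $ c i"
      using form_axis[OF i, of u] that[of "axis (c i) 1"] by (auto split: if_splits)
  qed
qed

lemma quadric_eq: "quadric p q c = pseudosphere"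
  unfolding quadric_def ambient_form_def[symmetric] pseudosphere_def ..

text \<open>
  Smoothness provides a lift \<open>\<Phi>\<close> on a whole neighbourhood of \<open>X\<close>, whereas preservation of the metric is
  witnessed at each point \<open>Y\<close> by a possibly different lift \<open>\<Psi>\<close>. Near \<open>Y\<close> the two agree up to a constant
  sign, which the metric does not see, so \<open>\<Phi>\<close> preserves the metric throughout its domain.
\<close>

lemma isometry_locally_linear:
  assumes F: "F \<in> Isom p q c" and X: "X \<in> pseudosphere"
  shows "\<exists>A\<in>orthogonal_group. \<exists>W. open W \<and> X \<in> W \<and>
    (\<forall>Y\<in>W \<inter> pseudosphere. F (orb Y) = orb (A Y))"
proof -
  obtain \<Phi> where "smooth_lift_at p q c F X \<Phi>"
    using F X unfolding Isom_def smooth_self_map_def quadric_eq by blast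
  then obtain U where U: "open U" "X \<in> U" and \<Phi>: "smooth_on U \<Phi>"
    and lift: "\<And>Y. Y \<in> U \<Longrightarrow> Y \<in> pseudosphere \<Longrightarrow> \<Phi> Y \<in> pseudosphere \<and> F (orb Y) = orb (\<Phi> Y)"
    unfolding smooth_lift_at_def quadric_eq by blast
  define \<Phi>' where "\<Phi>' Y = frechet_derivative \<Phi> (at Y)" for Y
  have \<Phi>': "(\<Phi> has_derivative \<Phi>' Y) (at Y)" "(\<lambda>Y. \<Phi>' Y v) differentiable (at Y)" if "Y \<in> U" for Y v
    using smooth_on_differentiable[OF \<Phi> that] by (simp_all add: \<Phi>'_def)
  have iso: "ambient_form (\<Phi>' Y v) (\<Phi>' Y w) = ambient_form v w"
    if Y: "Y \<in> U" "Y \<in> pseudosphere" and v: "ambient_form Y v = 0" and w: "ambient_form Y w = 0" for Y v w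
  proof -
    obtain \<Psi> where "smooth_lift_at p q c F Y \<Psi>"
      and "\<forall>v\<in>tangent p q c Y. \<forall>w\<in>tangent p q c Y.
        ambient_form (frechet_derivative \<Psi> (at Y) v) (frechet_derivative \<Psi> (at Y) w) = ambient_form v w"
      using F Y(2) unfolding Isom_def preserves_metric_def quadric_eq ambient_form_def[symmetric] by blast
    then obtain U' where U': "open U'" "Y \<in> U'" and \<Psi>: "smooth_on U' \<Psi>"
      and lift': "\<And>Z. Z \<in> U' \<Longrightarrow> Z \<in> pseudosphere \<Longrightarrow> F (orb Z) = orb (\<Psi> Z)"
      and metric: "ambient_form (frechet_derivative \<Psi> (at Y) v) (frechet_derivative \<Psi> (at Y) w) = ambient_form v w"
      using v w unfolding smooth_lift_at_def quadric_eq tangent_def ambient_form_def[symmetric] by blast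
    define \<Psi>' where "\<Psi>' = frechet_derivative \<Psi> (at Y)"
    have \<Psi>': "(\<Psi> has_derivative \<Psi>') (at Y)"
      using smooth_on_differentiable(1)[OF \<Psi> U'(2)] by (simp add: \<Psi>'_def)
    have "\<forall>\<^sub>F Z in nhds Y. Z \<in> U \<inter> U'"
      using U(1) U' Y(1) by (intro eventually_nhds_in_open) auto
    then have pm: "\<forall>\<^sub>F Z in nhds Y. Z \<in> pseudosphere \<longrightarrow> \<Psi> Z = \<Phi> Z \<or> \<Psi> Z = - \<Phi> Z"
      by eventually_elim (use lift lift' orb_eq_iff in \<open>metis IntE\<close>)
    have "\<Phi> Y \<noteq> 0"
      using lift[OF Y] by (auto simp: pseudosphere_def b_simps)
    then obtain s :: real where s: "s = 1 \<or> s = -1"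
      and near: "\<forall>\<^sub>F Z in nhds Y. Z \<in> pseudosphere \<longrightarrow> \<Psi> Z = s *\<^sub>R \<Phi> Z"
      by (rule eventually_same_sign[OF has_derivative_continuous[OF \<Phi>'(1)[OF Y(1)]]
          has_derivative_continuous[OF \<Psi>'] _ pm Y(2)])
    have sD: "((\<lambda>Z. s *\<^sub>R \<Phi> Z) has_derivative (\<lambda>v. s *\<^sub>R \<Phi>' Y v)) (at Y)"
      using \<Phi>'(1)[OF Y(1)] by (rule has_derivative_scaleR_right)
    have "\<Psi>' u = s *\<^sub>R \<Phi>' Y u" if "ambient_form Y u = 0" for u
      by (rule tangential_derivative_unique[OF Y(2) that sD \<Psi>' near])
    then show ?thesis
      using metric s v w by (auto simp: b_simps simp flip: \<Psi>'_def)
  qed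
  obtain A W where A: "A \<in> orthogonal_group" and W: "open W" "X \<in> W"
    and eq: "\<And>Y. Y \<in> W \<Longrightarrow> Y \<in> pseudosphere \<Longrightarrow> \<Phi> Y = A Y"
    using pseudosphere_local_isometry_linear[OF U X \<Phi>' _ iso] lift by blast
  have "\<forall>Y\<in>(W \<inter> U) \<inter> pseudosphere. F (orb Y) = orb (A Y)" using lift eq by simp
  then show ?thesis using A W U by (intro bexI[of _ A] exI[of _ "W \<inter> U"]) auto
qed

text \<open>
  Linear maps that agree up to sign on an open set agree up to one sign near a point, and equal germs of
  linear maps are equal.
\<close>

lemma linear_orb_unique:
  fixes A B :: "real ^ 'n \<Rightarrow> real ^ 'n"
  assumes A: "linear A" and B: "linear B" and inj: "\<And>Z. A Z = 0 \<Longrightarrow> Z = 0"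
    and V: "open V" "X \<in> V" "X \<noteq> 0"
    and eq: "\<And>Z. Z \<in> V \<Longrightarrow> orb (A Z) = orb (B Z)"
  shows "orb (A Z) = orb (B Z)"
proof -
  have DA: "(A has_derivative A) (at Z)" and DB: "(B has_derivative B) (at Z)" for Z
    using A B by (simp_all add: linear_imp_has_derivative)
  have "\<forall>\<^sub>F Z in nhds X. True \<longrightarrow> B Z = A Z \<or> B Z = - A Z"
    using eventually_nhds_in_open[OF V(1,2)]
    by eventually_elim (use eq in \<open>metis orb_eq_iff\<close>)
  from eventually_same_sign[OF has_derivative_continuous[OF DA] has_derivative_continuous[OF DB] _ this]
  obtain s :: real where s: "s = 1 \<or> s = -1" and near: "\<forall>\<^sub>F Z in nhds X. B Z = s *\<^sub>R A Z"
    using inj V(3) by auto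
  then obtain W where W: "open W" "X \<in> W" "\<And>Z. Z \<in> W \<Longrightarrow> B Z = s *\<^sub>R A Z"
    unfolding eventually_nhds by blast
  have "(B has_derivative (\<lambda>Z. s *\<^sub>R A Z)) (at X)"
    by (rule has_derivative_transform_within_open[OF has_derivative_scaleR_right[OF DA] W(1,2)])
      (simp add: W(3))
  from has_derivative_unique[OF DB this] have "B Z = s *\<^sub>R A Z" by (rule fun_cong)
  then show ?thesis using s by (auto simp: orb_eq_iff)
qed

lemma orb_apply_unit:
  assumes "linear A" "linear B" "X \<in> negative_cone"
  shows "orb (A (unit X)) = orb (B (unit X)) \<longleftrightarrow> orb (A X) = orb (B X)"
  using orb_eq_scaleR[of "inverse (radius X)" "A X" "B X"] radius_pos[OF assms(3)]
  by (simp add: unit_def linear_cmul[OF assms(1)] linear_cmul[OF assms(2)])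

text \<open>
  Globalisation by connectedness. The quadric itself may be disconnected (for \<open>q = 0\<close> it has two
  sheets), so the argument runs on \<open>K = {X. b X X < 0, b X o \<le> 0}\<close>: this set is star-shaped about \<open>o\<close>, since
  for \<open>Y\<close> on a segment from \<open>o\<close> to a point of \<open>K\<close> the terms in the expansion of \<open>b Y Y\<close> are nonpositive
  and not all zero, and it contains \<open>X\<close> or \<open>- X\<close> for every \<open>X\<close> in the cone.
\<close>

lemma isometry_induced:
  assumes F: "F \<in> Isom p q c"
  shows "\<exists>A\<in>orthogonal_group. \<forall>X\<in>pseudosphere. F (orb X) = orb (A X)"
proof -
  define o' :: "real ^ 'n" where "o' = axis (c (p + q + 1)) 1"
  have o_o: "ambient_form o' o' = -1" using form_axis[of "p + q + 1" o'] unfolding o'_def by simp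
  then have oS: "o' \<in> pseudosphere" and oN: "o' \<in> negative_cone"
    by (simp_all add: pseudosphere_def negative_cone_def)
  obtain A W\<^sub>0 where A: "A \<in> orthogonal_group" and W\<^sub>0: "open W\<^sub>0" "o' \<in> W\<^sub>0"
    "\<And>Y. Y \<in> W\<^sub>0 \<Longrightarrow> Y \<in> pseudosphere \<Longrightarrow> F (orb Y) = orb (A Y)"
    using isometry_locally_linear[OF F oS] by blast
  \<comment> \<open>\<open>P X\<close>: near the direction of \<open>X\<close> the isometry is induced by the map \<open>A\<close> found at \<open>o\<close>.\<close>
  define P where "P X \<longleftrightarrow> (\<exists>V. open V \<and> X \<in> V \<and> V \<subseteq> negative_cone \<and>
    (\<forall>Z\<in>V. F (orb (unit Z)) = orb (A (unit Z))))" for X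
  define K where "K = {X \<in> negative_cone. ambient_form X o' \<le> 0}"
  have oK: "o' \<in> K" using oN o_o by (simp add: K_def)
  have Po: "P o'" unfolding P_def
    by (rule exI[of _ "{X \<in> negative_cone. unit X \<in> W\<^sub>0}"])
      (use W\<^sub>0 oN open_unit_vimage radius_unit_pseudosphere(2)[OF oS] unit_in_pseudosphere in auto)
  have "starlike K"
    unfolding starlike_def
  proof (intro bexI[OF _ oK] ballI subsetI)
    fix X Y assume X: "X \<in> K" and "Y \<in> closed_segment o' X"
    then obtain t where t: "0 \<le> t" "t \<le> 1" and Y: "Y = (1 - t) *\<^sub>R o' + t *\<^sub>R X"
      unfolding closed_segment_def by blast
    have neg: "ambient_form X X < 0" "ambient_form X o' \<le> 0" using X by (simp_all add: K_def negative_cone_def)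
    have "ambient_form Y Y = - (1 - t)\<^sup>2 + 2 * t * (1 - t) * ambient_form X o' + t\<^sup>2 * ambient_form X X"
      unfolding Y by (simp add: b_simps o_o sym[of o' X] power2_eq_square algebra_simps)
    moreover have "2 * t * (1 - t) * ambient_form X o' \<le> 0" using t neg by (simp add: mult_nonneg_nonpos)
    moreover have "- (1 - t)\<^sup>2 + t\<^sup>2 * ambient_form X X < 0"
    proof (cases "t = 0")
      case False
      then have "t\<^sup>2 * ambient_form X X < 0" using neg by (simp add: mult_pos_neg)
      then show ?thesis using zero_le_power2[of "1 - t"] by linarith
    qed simp
    ultimately have "ambient_form Y Y < 0" by linarith
    moreover have "ambient_form Y o' \<le> 0"
      unfolding Y using t neg by (simp add: b_simps o_o mult_nonneg_nonpos add_nonpos_nonpos)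
    ultimately show "Y \<in> K" by (simp add: K_def negative_cone_def)
  qed
  then have "connected K" by (rule starlike_imp_connected)
  have PK: "P X" if "X \<in> K" for X
  proof (rule connected_induction_simple[where P=P, OF \<open>connected K\<close> oK that Po])
    fix X assume "X \<in> K"
    then have XN: "X \<in> negative_cone" by (simp add: K_def)
    obtain B W where B: "B \<in> orthogonal_group" and W: "open W" "unit X \<in> W"
      "\<And>Y. Y \<in> W \<Longrightarrow> Y \<in> pseudosphere \<Longrightarrow> F (orb Y) = orb (B Y)"
      using isometry_locally_linear[OF F unit_in_pseudosphere[OF XN]] by blast
    define V where "V = {X \<in> negative_cone. unit X \<in> W}"
    have V: "open V" "X \<in> V" "V \<subseteq> negative_cone"
      using open_unit_vimage[OF W(1)] W(2) XN by (auto simp: V_def)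
    have lin: "linear A" "linear B" using A B by (simp_all add: orthogonal_group_def)
    have inj: "A Z = 0 \<Longrightarrow> Z = 0" for Z
      using A b_preserving_eq_0 unfolding orthogonal_group_def by blast
    have step: "P z" if x: "x \<in> V" "P x" and z: "z \<in> V" for x z
    proof -
      obtain V' where V': "open V'" "x \<in> V'" "V' \<subseteq> negative_cone"
        "\<And>Z. Z \<in> V' \<Longrightarrow> F (orb (unit Z)) = orb (A (unit Z))"
        using x(2) unfolding P_def by blast
      have eqB: "F (orb (unit Z)) = orb (B (unit Z))" if "Z \<in> V" for Z
        using that W(3) unit_in_pseudosphere by (auto simp: V_def)
      have "orb (A Z) = orb (B Z)" if "Z \<in> V \<inter> V'" for Z
        using that V'(3,4) eqB[of Z] orb_apply_unit[OF lin, of Z] by auto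
      moreover have "x \<noteq> 0" using x(1) by (auto simp: V_def negative_cone_def b_simps)
      ultimately have "orb (A Z) = orb (B Z)" for Z
        using linear_orb_unique[OF lin inj open_Int[OF V(1) V'(1)]] x(1) V'(2) by auto
      then show "P z" unfolding P_def using V z eqB by auto
    qed
    show "\<exists>T. openin (top_of_set K) T \<and> X \<in> T \<and> (\<forall>x\<in>T. \<forall>y\<in>T. P x \<longrightarrow> P y)"
      by (rule exI[of _ "K \<inter> V"]) (use V(1,2) \<open>X \<in> K\<close> step in auto)
  qed
  have "F (orb X) = orb (A X)" if X: "X \<in> pseudosphere" for X
  proof -
    define X' where "X' = (if ambient_form X o' \<le> 0 then X else - X)"
    have "orb X' = orb X" "orb (A X') = orb (A X)"
      using A by (auto simp: X'_def orthogonal_group_def linear_neg)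
    moreover have "X' \<in> K" and "X' \<in> pseudosphere"
      using X pseudosphere_subset by (auto simp: X'_def K_def pseudosphere_def negative_cone_def b_simps)
    moreover have "F (orb X') = orb (A X')"
      using PK[OF \<open>X' \<in> K\<close>] radius_unit_pseudosphere(2)[OF \<open>X' \<in> pseudosphere\<close>] unfolding P_def by metis
    ultimately show ?thesis by simp
  qed
  then show ?thesis using A by blast
qed

lemma orthogonal_group_compose:
  "A \<in> orthogonal_group \<Longrightarrow> B \<in> orthogonal_group \<Longrightarrow> A \<circ> B \<in> orthogonal_group"
  by (simp add: orthogonal_group_def linear_compose)

lemma orthogonal_group_id: "id \<in> orthogonal_group"
  by (simp add: orthogonal_group_def linear_id)

lemma orthogonal_group_uminus: "A \<in> orthogonal_group \<Longrightarrow> (\<lambda>X. - A X) \<in> orthogonal_group"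
  by (simp add: orthogonal_group_def linear_compose_neg b_simps)

lemma orthogonal_group_inverse:
  assumes "A \<in> orthogonal_group"
  shows "\<exists>A'\<in>orthogonal_group. (\<forall>X. A' (A X) = X) \<and> (\<forall>X. A (A' X) = X)"
proof -
  have lin: "linear A" and iso: "\<And>u v. ambient_form (A u) (A v) = ambient_form u v"
    using assms by (simp_all add: orthogonal_group_def)
  have surj: "surj A" by (rule b_preserving_surj[OF lin iso])
  then have inj: "inj A" using linear_surjective_imp_injective lin by blast
  obtain A' where A': "linear A'" "A' \<circ> A = id" using linear_injective_left_inverse[OF lin inj] by blast
  have left: "A' (A X) = X" for X using A'(2) by (metis comp_apply id_apply)
  have right: "A (A' X) = X" for X using left surj by (metis surjD)
  have "ambient_form (A' u) (A' v) = ambient_form u v" for u v using iso[of "A' u" "A' v"] right by simp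
  then show ?thesis using A'(1) left right by (auto simp: orthogonal_group_def)
qed

lemma orthogonal_group_pseudosphere:
  "A \<in> orthogonal_group \<Longrightarrow> X \<in> pseudosphere \<Longrightarrow> A X \<in> pseudosphere"
  by (simp add: orthogonal_group_def pseudosphere_def)

definition induced :: "(real ^ 'n \<Rightarrow> real ^ 'n) \<Rightarrow> (real ^ 'n) set \<Rightarrow> (real ^ 'n) set" where
  "induced A = restrict ((`) A) (Hpq p q c)"

lemma Hpq_eq: "Hpq p q c = orb ` pseudosphere"
  by (simp add: Hpq_def quadric_eq)

lemma induced_orb:
  "A \<in> orthogonal_group \<Longrightarrow> X \<in> pseudosphere \<Longrightarrow> induced A (orb X) = orb (A X)"
  by (simp add: induced_def Hpq_eq image_orb orthogonal_group_def)

lemma induced_Hpq: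
  "A \<in> orthogonal_group \<Longrightarrow> x \<in> Hpq p q c \<Longrightarrow> induced A x \<in> Hpq p q c"
  using induced_orb orthogonal_group_pseudosphere unfolding Hpq_eq by auto

lemma induced_unique:
  assumes "A \<in> orthogonal_group" "f \<in> extensional (Hpq p q c)"
    and "\<And>X. X \<in> pseudosphere \<Longrightarrow> f (orb X) = orb (A X)"
  shows "f = induced A"
proof (rule extensionalityI[OF assms(2)])
  show "induced A \<in> extensional (Hpq p q c)" by (simp add: induced_def)
  show "f x = induced A x" if "x \<in> Hpq p q c" for x
    using that assms induced_orb unfolding Hpq_eq by auto
qed

lemma induced_compose:
  assumes "A \<in> orthogonal_group" "B \<in> orthogonal_group"
  shows "compose (Hpq p q c) (induced A) (induced B) = induced (A \<circ> B)"
proof (rule induced_unique)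
  show "A \<circ> B \<in> orthogonal_group" using assms by (rule orthogonal_group_compose)
  show "compose (Hpq p q c) (induced A) (induced B) (orb X) = orb ((A \<circ> B) X)" if "X \<in> pseudosphere" for X
    using that assms orthogonal_group_pseudosphere by (simp add: compose_eq Hpq_eq induced_orb)
qed simp

lemma induced_id: "induced id = (\<lambda>x\<in>Hpq p q c. x)"
  by (auto simp: induced_def fun_eq_iff)

lemma induced_inverse:
  assumes A: "A \<in> orthogonal_group" and A': "A' \<in> orthogonal_group" and "\<And>X. A' (A X) = X"
    and x: "x \<in> Hpq p q c"
  shows "induced A' (induced A x) = x"
  using x assms orthogonal_group_pseudosphere[OF A] by (auto simp: Hpq_eq induced_orb)

lemma induced_Bij:
  assumes A: "A \<in> orthogonal_group"
  shows "induced A \<in> Bij (Hpq p q c)"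
proof -
  obtain A' where A': "A' \<in> orthogonal_group" "\<And>X. A' (A X) = X" "\<And>X. A (A' X) = X"
    using orthogonal_group_inverse[OF A] by blast
  have "bij_betw (induced A) (Hpq p q c) (Hpq p q c)"
    by (rule bij_betw_byWitness[where f' = "induced A'"])
      (use A A' in \<open>auto simp: induced_inverse induced_Hpq\<close>)
  then show ?thesis by (simp add: Bij_def induced_def)
qed

lemma linear_lift:
  assumes A: "A \<in> orthogonal_group" and "\<And>Y. Y \<in> pseudosphere \<Longrightarrow> F (orb Y) = orb (A Y)"
  shows "smooth_lift_at p q c F X A"
proof -
  have "smooth_on UNIV A"
    using A smooth_on_affine[of UNIV A A 0] by (simp add: orthogonal_group_def)
  then show ?thesis
    using assms orthogonal_group_pseudosphere[OF A] unfolding smooth_lift_at_def quadric_eq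
    by (intro exI[of _ UNIV]) auto
qed

lemma induced_Isom:
  assumes A: "A \<in> orthogonal_group"
  shows "induced A \<in> Isom p q c"
proof -
  obtain A' where A': "A' \<in> orthogonal_group" "\<And>X. A' (A X) = X" "\<And>X. A (A' X) = X"
    using orthogonal_group_inverse[OF A] by blast
  have "smooth_self_map p q c (induced A)"
    unfolding smooth_self_map_def using linear_lift[OF A] induced_orb[OF A] by blast
  moreover have "smooth_self_map p q c (inv_into (Hpq p q c) (induced A))"
  proof -
    have "inv_into (Hpq p q c) (induced A) (orb Y) = orb (A' Y)" if "Y \<in> pseudosphere" for Y
    proof (rule inv_into_f_eq)
      show "inj_on (induced A) (Hpq p q c)"
        using induced_Bij[OF A] by (simp add: Bij_def bij_betw_def)
    qed (use that A A' orthogonal_group_pseudosphere[OF A'(1)] in \<open>auto simp: Hpq_eq induced_orb\<close>)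
    then show ?thesis
      unfolding smooth_self_map_def using linear_lift[OF A'(1)] by blast
  qed
  moreover have "preserves_metric p q c (induced A)"
    unfolding preserves_metric_def ambient_form_def[symmetric]
  proof (intro ballI exI conjI)
    fix X v w
    show "smooth_lift_at p q c (induced A) X A"
      using linear_lift[OF A] induced_orb[OF A] by blast
    have "(A has_derivative A) (at X)"
      using A by (simp add: orthogonal_group_def linear_imp_has_derivative)
    from frechet_derivative_at[OF this]
    show "ambient_form (frechet_derivative A (at X) v) (frechet_derivative A (at X) w) = ambient_form v w"
      using A by (simp add: orthogonal_group_def)
  qed
  ultimately show ?thesis using induced_Bij[OF A] by (simp add: Isom_def)
qed

text \<open>
  With this description the group laws for isometries reduce to those for linear maps, and no chain rule
  for the smooth structure of the quotient has to be developed.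
\<close>

theorem Isom_eq_induced: "Isom p q c = induced ` orthogonal_group"
proof
  show "induced ` orthogonal_group \<subseteq> Isom p q c" using induced_Isom by blast
  show "Isom p q c \<subseteq> induced ` orthogonal_group"
  proof
    fix F assume F: "F \<in> Isom p q c"
    then obtain A where A: "A \<in> orthogonal_group" "\<And>X. X \<in> pseudosphere \<Longrightarrow> F (orb X) = orb (A X)"
      using isometry_induced by blast
    moreover have "F \<in> extensional (Hpq p q c)" using F by (simp add: Isom_def Bij_def)
    ultimately have "F = induced A" by (intro induced_unique) auto
    then show "F \<in> induced ` orthogonal_group" using A(1) by blast
  qed
qed

lemma induced_mult:
  assumes "A \<in> orthogonal_group" "B \<in> orthogonal_group"
  shows "induced A \<otimes>\<^bsub>BijGroup (Hpq p q c)\<^esub> induced B = induced (A \<circ> B)"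
  using assms by (simp add: BijGroup_def induced_Bij induced_compose)

lemma Isom_subgroup: "subgroup (Isom p q c) (BijGroup (Hpq p q c))"
proof
  show "Isom p q c \<subseteq> carrier (BijGroup (Hpq p q c))"
    by (auto simp: BijGroup_def Isom_def)
  show "\<one>\<^bsub>BijGroup (Hpq p q c)\<^esub> \<in> Isom p q c"
    using induced_Isom[OF orthogonal_group_id] by (simp add: BijGroup_def induced_id)
  show "F \<otimes>\<^bsub>BijGroup (Hpq p q c)\<^esub> F' \<in> Isom p q c" if "F \<in> Isom p q c" "F' \<in> Isom p q c" for F F'
    using that induced_mult orthogonal_group_compose unfolding Isom_eq_induced by auto
  show "inv\<^bsub>BijGroup (Hpq p q c)\<^esub> F \<in> Isom p q c" if F: "F \<in> Isom p q c" for F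
  proof -
    obtain A where A: "A \<in> orthogonal_group" "F = induced A"
      using F unfolding Isom_eq_induced by blast
    obtain A' where A': "A' \<in> orthogonal_group" "\<And>X. A' (A X) = X" "\<And>X. A (A' X) = X"
      using orthogonal_group_inverse[OF A(1)] by blast
    have "A' \<circ> A = id" using A'(2) by auto
    then have "induced A' \<otimes>\<^bsub>BijGroup (Hpq p q c)\<^esub> induced A = \<one>\<^bsub>BijGroup (Hpq p q c)\<^esub>"
      by (simp only: induced_mult[OF A'(1) A(1)]) (simp add: induced_id BijGroup_def)
    then have "inv\<^bsub>BijGroup (Hpq p q c)\<^esub> F = induced A'"
      unfolding A(2)
      by (rule group.inv_equality[OF group_BijGroup])
        (use A(1) A'(1) induced_Bij in \<open>auto simp: BijGroup_def\<close>)
    then show ?thesis using induced_Isom[OF A'(1)] by simp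
  qed
qed

end

section \<open>Null coordinates\<close>

lemma from_coords_nth:
  assumes "inj_on c {1..d}" "j \<in> {1..d}"
  shows "from_coords d c a $ c j = a j"
proof -
  have "from_coords d c a $ c j = (\<Sum>i=1..d. if i = j then a j else 0)"
    unfolding from_coords_def sum_component
    by (intro sum.cong) (use assms in \<open>auto simp: axis_def inj_on_eq_iff\<close>)
  then show ?thesis using assms(2) by simp
qed

context half_space_model
begin

text \<open>
  The polarisation of \<open>h\<close>.
\<close>

definition horiz_form :: "real ^ 'm \<Rightarrow> real ^ 'm \<Rightarrow> real" where
  "horiz_form = form (p - 1) q e"

text \<open>
  \<open>\<real>\<^sup>p\<^sup>-\<^sup>1 \<oplus> \<real>\<^sup>q\<close> sits in the ambient space with the coordinates \<open>p\<close> and \<open>p + q + 1\<close> left free for the null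
  vectors below; the coordinates of \<open>y\<close> therefore shift by one. The projection \<open>hproj\<close> undoes this.
\<close>

definition emb :: "real ^ 'm \<Rightarrow> real ^ 'n" where
  "emb v = from_coords (p + q + 1) c
     (\<lambda>i. if i < p then v $ e i else if i = p then 0 else if i \<le> p + q then v $ e (i - 1) else 0)"

definition hproj :: "real ^ 'n \<Rightarrow> real ^ 'm" where
  "hproj X = from_coords (p + q) e
     (\<lambda>i. if i < p then X $ c i else if i < p + q then X $ c (i + 1) else 0)"

text \<open>
  The isotropic basis of the hyperbolic plane spanned by the coordinates \<open>p\<close> and \<open>p + q + 1\<close>. The line
  of \<open>n0\<close> corresponds to the point at infinity of the half-space, that of \<open>m0\<close> to the origin.
\<close>

definition n0 :: "real ^ 'n" where
  "n0 = axis (c (p + q + 1)) 1 - axis (c p) 1"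

definition m0 :: "real ^ 'n" where
  "m0 = axis (c (p + q + 1)) 1 + axis (c p) 1"

lemma emb_nth:
  "i \<in> {1..p + q + 1} \<Longrightarrow> emb v $ c i =
     (if i < p then v $ e i else if i = p then 0 else if i \<le> p + q then v $ e (i - 1) else 0)"
  unfolding emb_def by (rule from_coords_nth[OF bij_betw_imp_inj_on[OF c]])

lemma hproj_nth:
  "i \<in> {1..p + q} \<Longrightarrow> hproj X $ e i =
     (if i < p then X $ c i else if i < p + q then X $ c (i + 1) else 0)"
  unfolding hproj_def by (rule from_coords_nth[OF bij_betw_imp_inj_on[OF e]])

lemma axis_nth:
  "i \<in> {1..p + q + 1} \<Longrightarrow> j \<in> {1..p + q + 1} \<Longrightarrow> axis (c j) 1 $ c i = (if i = j then 1 else 0 :: real)"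
  using c_eq_iff by (auto simp: axis_def)

lemma linear_emb: "linear emb"
  by (rule linearI; rule vec_eq_c) (simp_all add: emb_nth)

lemma linear_hproj: "linear hproj"
  by (rule linearI; rule vec_eq_e) (simp_all add: hproj_nth)

lemma ambient_form_emb: "ambient_form (emb v) X = horiz_form v (hproj X)"
proof -
  have p': "{p - 1 + 1..p - 1 + q} = {p..p + q - 1}" "{Suc p..Suc (p + q - 1)} = {p + 1..p + q}"
    using p by auto
  have 1: "(\<Sum>i=1..p - 1. emb v $ c i * X $ c i) = (\<Sum>i=1..p - 1. v $ e i * hproj X $ e i)"
    by (rule sum.cong) (auto simp: emb_nth hproj_nth)
  have "(\<Sum>i=p+1..p+q. emb v $ c i * X $ c i) = (\<Sum>i=p..p+q-1. emb v $ c (Suc i) * X $ c (Suc i))"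
    unfolding p'(2)[symmetric] by (rule sum.shift_bounds_cl_Suc_ivl)
  also have "\<dots> = (\<Sum>i=p..p+q-1. v $ e i * hproj X $ e i)"
    using p by (intro sum.cong) (auto simp: emb_nth hproj_nth)
  finally have 2: "(\<Sum>i=p+1..p+q. emb v $ c i * X $ c i) = (\<Sum>i=p..p+q-1. v $ e i * hproj X $ e i)" .
  have 3: "{1..p} = insert p {1..p - 1}" "{p + 1..p + (q + 1)} = insert (p + q + 1) {p + 1..p + q}"
    using p by auto
  have "ambient_form (emb v) X = (\<Sum>i=1..p - 1. emb v $ c i * X $ c i) - (\<Sum>i=p+1..p+q. emb v $ c i * X $ c i)"
    unfolding ambient_form_def form_def 3 using p by (subst (1 2) sum.insert) (auto simp: emb_nth)
  then show ?thesis unfolding 1 2 horiz_form_def form_def p'(1) .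
qed

lemma ambient_form_n0: "ambient_form n0 X = - X $ c p - X $ c (p + q + 1)"
  using form_axis[of p X] form_axis[of "p + q + 1" X] p
  by (simp add: n0_def b_simps sym[of "axis (c p) 1" X] sym[of "axis (c (Suc (p + q))) 1" X])

lemma ambient_form_m0: "ambient_form m0 X = X $ c p - X $ c (p + q + 1)"
  using form_axis[of p X] form_axis[of "p + q + 1" X] p
  by (simp add: m0_def b_simps sym[of "axis (c p) 1" X] sym[of "axis (c (Suc (p + q))) 1" X])

lemma n0_nth: "i \<in> {1..p + q + 1} \<Longrightarrow> n0 $ c i = (if i = p then -1 else if i = p + q + 1 then 1 else 0)"
  using p by (simp add: n0_def axis_nth)

lemma m0_nth: "i \<in> {1..p + q + 1} \<Longrightarrow> m0 $ c i = (if i = p then 1 else if i = p + q + 1 then 1 else 0)"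
  using p by (simp add: m0_def axis_nth)

lemma decomposition:
  "X = emb (hproj X) + (- ambient_form n0 X / 2) *\<^sub>R m0 + (- ambient_form m0 X / 2) *\<^sub>R n0"
proof (rule vec_eq_c)
  fix i assume i: "i \<in> {1..p + q + 1}"
  consider "i < p" | "i = p" | "p < i" "i \<le> p + q" | "i = p + q + 1" using i by force
  then show "X $ c i = (emb (hproj X) + (- ambient_form n0 X / 2) *\<^sub>R m0 + (- ambient_form m0 X / 2) *\<^sub>R n0) $ c i"
  proof cases
    case 3
    then have "i - 1 \<in> {1..p + q}" "\<not> i - 1 < p" "i - 1 < p + q" using p by auto
    then show ?thesis using 3 i by (simp add: emb_nth n0_nth m0_nth hproj_nth)
  qed (use i p in \<open>simp_all add: emb_nth n0_nth m0_nth hproj_nth ambient_form_n0 ambient_form_m0 field_simps\<close>)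
qed

lemma zc_hproj: "zc p q e (hproj X) = 0"
  using p by (simp add: zc_def hproj_nth)

lemma hor_nth: "i \<in> {1..p + q} \<Longrightarrow> hor p q e v $ e i = (if i = p + q then 0 else v $ e i)"
  using e_eq_iff[of i "p + q"] p by (auto simp: hor_def vert_def zc_def axis_def)

lemma hproj_emb: "hproj (emb v) = hor p q e v"
  by (rule vec_eq_e) (auto simp: hproj_nth emb_nth hor_nth)

lemma hproj_n0: "hproj n0 = 0" and hproj_m0: "hproj m0 = 0"
  by (rule vec_eq_e, auto simp: hproj_nth n0_nth m0_nth)+

lemma null_pair:
  "ambient_form n0 n0 = 0" "ambient_form m0 m0 = 0" "ambient_form n0 m0 = -2" "ambient_form m0 n0 = -2"
  "ambient_form n0 (emb v) = 0" "ambient_form m0 (emb v) = 0" "ambient_form (emb v) n0 = 0" "ambient_form (emb v) m0 = 0"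
  using p by (simp_all add: ambient_form_n0 ambient_form_m0 n0_nth m0_nth emb_nth ambient_form_emb hproj_n0 hproj_m0)
    (simp_all add: horiz_form_def form_def)

lemma horiz_form_hor: "horiz_form v (hor p q e w) = horiz_form v w"
proof -
  have "w' $ e i = w $ e i" if "i \<in> {1..p - 1} \<union> {p - 1 + 1..p - 1 + q}" "w' = hor p q e w" for i w'
  proof -
    have "i \<in> {1..p + q}" "i \<noteq> p + q" using that(1) p by auto
    then show ?thesis using that(2) by (simp add: hor_nth)
  qed
  then show ?thesis unfolding horiz_form_def form_def
    by (intro arg_cong2[where f = "(-)"] sum.cong arg_cong2[where f = "(*)"]) auto
qed

lemma ambient_form_emb_emb: "ambient_form (emb v) (emb w) = horiz_form v w"
  by (simp add: ambient_form_emb hproj_emb horiz_form_hor)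

lemma horiz_form_sym: "horiz_form u v = horiz_form v u"
  by (simp add: horiz_form_def form_sym)

lemma linear_zc: "linear (zc p q e)"
  by (rule linearI) (simp_all add: zc_def)

lemma linear_vert: "linear (vert p q e)"
  by (rule linearI) (simp_all add: vert_def scaleR_add_left)

lemma linear_hor: "linear (hor p q e)"
  unfolding hor_def[abs_def]
  by (intro linear_compose_sub linear_ident linear_compose[OF linear_zc linear_vert, unfolded o_def])

lemma zc_vert: "zc p q e (vert p q e t) = t"
  by (simp add: zc_def vert_def)

lemma zc_hor: "zc p q e (hor p q e v) = 0"
  using linear_diff[OF linear_zc] by (simp add: hor_def zc_vert)

lemma hor_horiz: "v \<in> horiz p q e \<Longrightarrow> hor p q e v = v"
  using linear_0[OF linear_vert] by (simp add: hor_def horiz_def)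

lemma hor_vert: "hor p q e (vert p q e t) = 0"
  by (simp add: hor_def zc_vert)

lemma bilinear_horiz_form: "bilinear horiz_form"
  unfolding horiz_form_def by (rule bilinear_form)

lemmas horiz_form_simps =
  bilinear_ladd[OF bilinear_horiz_form] bilinear_radd[OF bilinear_horiz_form]
  bilinear_lmul[OF bilinear_horiz_form] bilinear_rmul[OF bilinear_horiz_form]
  bilinear_lzero[OF bilinear_horiz_form] bilinear_rzero[OF bilinear_horiz_form]

lemma horiz_form_vert: "horiz_form v (vert p q e t) = 0"
  using horiz_form_hor[of v "vert p q e t"] by (simp add: hor_vert horiz_form_simps)

lemma horiz_form_nondegenerate:
  assumes "v \<in> horiz p q e" "\<And>w. w \<in> horiz p q e \<Longrightarrow> horiz_form v w = 0"
  shows "v = 0"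
proof -
  have "emb v = 0"
    by (rule nondeg) (simp add: ambient_form_emb assms(2) horiz_def zc_hproj)
  then have "hor p q e v = 0" using linear_0[OF linear_hproj] hproj_emb[of v] by simp
  then show ?thesis using hor_horiz[OF assms(1)] by simp
qed

text \<open>
  Up to the factor \<open>1 / z\<close> the point \<open>(x,y,z)\<close> lifts to \<open>(x,y) + (m0 + (h(x,y) + z\<^sup>2) n0) / 2\<close>: the
  half-space coordinates are horospherical coordinates centred at \<open>n0\<close>.
\<close>

definition iota_vec :: "real ^ 'm \<Rightarrow> real ^ 'n" where
  "iota_vec P = (1 / zc p q e P) *\<^sub>R emb P + (1 / (2 * zc p q e P)) *\<^sub>R m0
     + ((h p q e P + (zc p q e P)\<^sup>2) / (2 * zc p q e P)) *\<^sub>R n0"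

lemma iota_eq: "iota p q e c P = orb (iota_vec P)"
proof -
  have "from_coords (p + q + 1) c (\<lambda>i.
       if i < p then P $ e i / zc p q e P
       else if i = p then (1 - h p q e P - (zc p q e P)\<^sup>2) / (2 * zc p q e P)
       else if i \<le> p + q then P $ e (i - 1) / zc p q e P
       else (1 + h p q e P + (zc p q e P)\<^sup>2) / (2 * zc p q e P)) = iota_vec P"
  proof (rule vec_eq_c, goal_cases)
    case (1 i)
    then show ?case
      unfolding from_coords_nth[OF bij_betw_imp_inj_on[OF c] 1] iota_vec_def
      by (auto simp: emb_nth n0_nth m0_nth diff_divide_distrib add_divide_distrib)
  qed
  then show ?thesis unfolding iota_def Let_def by simp
qed

lemma emb_hor: "emb (hor p q e v) = emb v"
proof (rule vec_eq_c)
  fix i assume i: "i \<in> {1..p + q + 1}"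
  have hn: "hor p q e v $ e j = v $ e j" if "j \<in> {1..p + q}" "j \<noteq> p + q" for j
    using that by (simp add: hor_nth)
  have "i < p \<Longrightarrow> hor p q e v $ e i = v $ e i"
    using i by (intro hn) auto
  moreover have "p < i \<Longrightarrow> i \<le> p + q \<Longrightarrow> hor p q e v $ e (i - 1) = v $ e (i - 1)"
    using p by (intro hn) auto
  ultimately show "emb (hor p q e v) $ c i = emb v $ c i"
    using i by (simp add: emb_nth)
qed

lemma emb_vert: "emb (vert p q e r) = 0"
  using emb_hor[of "vert p q e r"] linear_0[OF linear_emb] by (simp add: hor_vert)

lemma h_eq: "h p q e P = horiz_form P P"
  by (simp add: h_def horiz_form_def)

lemma iota_vec_pseudosphere:
  assumes "zc p q e P \<noteq> 0"
  shows "iota_vec P \<in> pseudosphere"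
  using assms
  by (simp add: iota_vec_def pseudosphere_def b_simps null_pair ambient_form_emb_emb h_eq field_simps power2_eq_square)

lemma ambient_form_n0_iota_vec: "ambient_form n0 (iota_vec P) = - 1 / zc p q e P"
  by (simp add: iota_vec_def b_simps null_pair)

lemma hproj_iota_vec: "hproj (iota_vec P) = (1 / zc p q e P) *\<^sub>R hor p q e P"
  by (simp add: iota_vec_def linear_add[OF linear_hproj] linear_cmul[OF linear_hproj]
      hproj_n0 hproj_m0 hproj_emb)

lemma ambient_form_self: "ambient_form X X = horiz_form (hproj X) (hproj X) - ambient_form n0 X * ambient_form m0 X"
proof -
  have "ambient_form X X = ambient_form (emb (hproj X) + (- ambient_form n0 X / 2) *\<^sub>R m0 + (- ambient_form m0 X / 2) *\<^sub>R n0)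
      (emb (hproj X) + (- ambient_form n0 X / 2) *\<^sub>R m0 + (- ambient_form m0 X / 2) *\<^sub>R n0)"
    using decomposition[of X] by metis
  also have "\<dots> = horiz_form (hproj X) (hproj X) - ambient_form n0 X * ambient_form m0 X"
    by (simp only: b_simps null_pair ambient_form_emb_emb) (simp add: field_simps)
  finally show ?thesis .
qed

text \<open>
  The equation of the quadric is linear in the coordinate along \<open>n0\<close>, with a multiple of \<open>ambient_form n0 X\<close> as
  coefficient, so that coordinate can be solved for. This spares the comparison of the last coordinates in the next
  section.
\<close>

lemma pseudosphere_eqI:
  assumes "X \<in> pseudosphere" "Y \<in> pseudosphere"
    and "ambient_form n0 X = ambient_form n0 Y" "ambient_form n0 X \<noteq> 0" "hproj X = hproj Y"
  shows "X = Y"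
proof -
  have "horiz_form (hproj Y) (hproj Y) - ambient_form n0 Y * ambient_form m0 X = -1"
    using assms ambient_form_self[of X] by (simp add: pseudosphere_def)
  moreover have "horiz_form (hproj Y) (hproj Y) - ambient_form n0 Y * ambient_form m0 Y = -1"
    using assms ambient_form_self[of Y] by (simp add: pseudosphere_def)
  ultimately have "ambient_form n0 Y * ambient_form m0 X = ambient_form n0 Y * ambient_form m0 Y" by linarith
  then have "ambient_form m0 X = ambient_form m0 Y" using assms(3,4) by simp
  then show ?thesis using decomposition[of X] decomposition[of Y] assms(3,5) by simp
qed

section \<open>Similarities of the half-space are the stabiliser of a null line\<close>

text \<open>
  The map is the restriction of an affine map of the ambient vector space whose linear part \<open>L\<close> scales
  both \<open>horiz_form\<close> and \<open>z\<close>; nondegeneracy of \<open>horiz_form\<close> on horizontal vectors makes \<open>L\<close> invertible, so smoothness and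
  bijectivity hold in both directions, and the scaling cancels in the metric.
\<close>

lemma similarity_in_G:
  assumes lam: "lam > 0" and A: "A \<in> orth p q e" and t: "t \<in> horiz p q e"
  shows "(\<lambda>P. lam *\<^sub>R (A (hor p q e P) + t + vert p q e (zc p q e P))) \<in> G p q e"
proof -
  let ?HS = "half_space p q e"
  have linA: "linear A" and A_horiz: "\<And>v. v \<in> horiz p q e \<Longrightarrow> A v \<in> horiz p q e"
    and A_hf: "\<And>u v. u \<in> horiz p q e \<Longrightarrow> v \<in> horiz p q e \<Longrightarrow> horiz_form (A u) (A v) = horiz_form u v"
    using A by (auto simp: orth_def horiz_form_def)
  have hor_in: "hor p q e v \<in> horiz p q e" for v by (simp add: horiz_def zc_hor)
  define L where "L P = lam *\<^sub>R (A (hor p q e P) + vert p q e (zc p q e P))" for P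
  define g where "g P = lam *\<^sub>R (A (hor p q e P) + t + vert p q e (zc p q e P))" for P
  have g: "g P = L P + lam *\<^sub>R t" for P by (simp add: g_def L_def algebra_simps)
  have linL: "linear L"
    unfolding L_def[abs_def]
    by (intro linear_compose_scale_right linear_compose_add
        linear_compose[OF linear_hor linA, unfolded o_def] linear_compose[OF linear_zc linear_vert, unfolded o_def])
  have zcL: "zc p q e (L P) = lam * zc p q e P" for P
    using A_horiz[OF hor_in[of P]]
    by (simp add: L_def linear_cmul[OF linear_zc] linear_add[OF linear_zc] zc_vert horiz_def)
  have zcg: "zc p q e (g P) = lam * zc p q e P" for P
    using t by (simp add: g linear_add[OF linear_zc] linear_cmul[OF linear_zc] zcL horiz_def)
  have hfL: "horiz_form (L u) (L v) = lam\<^sup>2 * horiz_form u v" for u v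
  proof -
    have "horiz_form (L u) (L v) = lam\<^sup>2 * horiz_form (A (hor p q e u)) (A (hor p q e v))"
      using horiz_form_vert horiz_form_sym by (simp add: L_def horiz_form_simps power2_eq_square)
    also have "horiz_form (A (hor p q e u)) (A (hor p q e v)) = horiz_form u v"
      using A_hf[OF hor_in hor_in, of u v] horiz_form_hor[of "hor p q e u" v] horiz_form_hor[of v u]
        horiz_form_sym[of "hor p q e u" v] horiz_form_sym[of v u] by simp
    finally show ?thesis .
  qed
  have "P = 0" if LP: "L P = 0" for P
  proof -
    have z: "zc p q e P = 0" using zcL[of P] LP lam linear_0[OF linear_zc] by simp
    have "horiz_form P w = 0" for w using hfL[of P w] LP lam by (simp add: horiz_form_simps)
    then show ?thesis using z by (intro horiz_form_nondegenerate) (auto simp: horiz_def)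
  qed
  then have injL: "inj L" using linear_injective_0[OF linL] by blast
  then obtain L' where L': "linear L'" "L' \<circ> L = id" using linear_injective_left_inverse[OF linL] by blast
  have left: "L' (L P) = P" for P using L'(2) by (metis comp_apply id_apply)
  have right: "L (L' P) = P" for P
    using left linear_injective_imp_surjective[OF linL injL] by (metis surjD)
  define g' where "g' P = L' P + L' (- lam *\<^sub>R t)" for P
  have g'g: "g' (g P) = P" and gg': "g (g' P) = P" for P
    by (simp_all add: g g'_def left right flip: linear_add[OF L'(1)])
  have zcg': "zc p q e (g' P) = zc p q e P / lam" for P
    using zcg[of "g' P"] gg' lam by simp
  have bij: "bij_betw g ?HS ?HS"
    by (rule bij_betw_byWitness[where f' = g'])
      (use lam in \<open>auto simp: g'g gg' half_space_def zcg zcg'\<close>)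
  have op: "open ?HS"
    unfolding half_space_def zc_def by (intro open_Collect_less continuous_intros)
  have "inv_into ?HS g P = g' P" if "P \<in> ?HS" for P
    by (rule inv_into_f_eq) (use bij that lam in \<open>auto simp: bij_betw_def gg' half_space_def zcg'\<close>)
  then have smooth': "smooth_on ?HS (inv_into ?HS g)"
    by (intro smooth_on_affine[OF op L'(1)]) (simp add: g'_def)
  have smooth: "smooth_on ?HS g"
    by (rule smooth_on_affine[OF op linL g])
  have dg: "frechet_derivative g (at P) = L" for P
    using frechet_derivative_at[OF has_derivative_affine[OF linL, of "lam *\<^sub>R t" P]] by (simp add: g[abs_def])
  have metric: "hs_metric p q e (g P) (L u) (L v) = hs_metric p q e P u v" for P u v
  proof -
    have "hs_metric p q e (g P) (L u) (L v)
        = (lam\<^sup>2 * (horiz_form u v + zc p q e u * zc p q e v)) / (lam\<^sup>2 * (zc p q e P)\<^sup>2)"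
      unfolding hs_metric_def horiz_form_def[symmetric] hfL zcL zcg
      by (simp only: power_mult_distrib distrib_left power2_eq_square mult_ac)
    also have "\<dots> = hs_metric p q e P u v"
      unfolding hs_metric_def horiz_form_def[symmetric] using lam by (intro mult_divide_mult_cancel_left) simp
    finally show ?thesis .
  qed
  have "hs_isometry p q e g"
    using bij smooth smooth' metric by (simp add: hs_isometry_def dg)
  then show ?thesis
    using assms unfolding G_def g_def[abs_def] by blast
qed

text \<open>
  Since \<open>B\<close> scales \<open>n0\<close> by \<open>k\<close>, it scales the functional \<open>ambient_form n0\<close>, that is \<open>- 1 / z\<close>, by \<open>1 / k\<close>, and it acts
  on the quotient of the hyperplane orthogonal to \<open>n0\<close> by the line of \<open>n0\<close>, a copy of the horizontal space.
  This action is the rotation \<open>A\<close>, and the horizontal part of \<open>B m0\<close> gives the translation.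
\<close>

lemma stabilizer_extends_similarity:
  assumes B: "B \<in> orthogonal_group" and k: "k > 0" and Bn: "B n0 = k *\<^sub>R n0"
  shows "\<exists>g\<in>G p q e. induced B \<in> extensions p q e c (half_space p q e) g"
proof -
  have lin: "linear B" and iso: "\<And>u v. ambient_form (B u) (B v) = ambient_form u v"
    using B by (simp_all add: orthogonal_group_def)
  have n0B: "ambient_form n0 (B X) = ambient_form n0 X / k" for X
    using iso[of n0 X] k unfolding Bn by (simp add: b_simps field_simps)
  define A where "A v = hproj (B (emb v))" for v
  \<comment> \<open>The coefficient of \<open>m0\<close> in the lift of \<open>(x,y,z)\<close> is \<open>1 / (2 z)\<close>, whence the factor \<open>1 / 2\<close>.\<close>
  define t where "t = (1 / 2) *\<^sub>R hproj (B m0)"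
  have horiz_form_eq: "horiz_form (A u) (A v) = horiz_form u v" for u v
  proof -
    have dec: "B (emb w) = emb (A w) + (- ambient_form m0 (B (emb w)) / 2) *\<^sub>R n0" for w
      using decomposition[of "B (emb w)"] n0B[of "emb w"] by (simp add: A_def null_pair)
    have "horiz_form u v = ambient_form (B (emb u)) (B (emb v))" by (simp add: iso ambient_form_emb_emb)
    also have "\<dots> = horiz_form (A u) (A v)"
      by (subst (1 2) dec) (simp only: b_simps null_pair ambient_form_emb_emb, simp)
    finally show ?thesis ..
  qed
  have "linear A"
    unfolding A_def using linear_compose[OF linear_compose[OF linear_emb lin] linear_hproj]
    by (simp add: o_def)
  then have A: "A \<in> orth p q e"
    using horiz_form_eq by (auto simp: orth_def horiz_form_def horiz_def A_def zc_hproj)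
  have t: "t \<in> horiz p q e"
    by (simp add: t_def horiz_def linear_cmul[OF linear_zc] zc_hproj)
  define g where "g P = k *\<^sub>R (A (hor p q e P) + t + vert p q e (zc p q e P))" for P
  have gG: "g \<in> G p q e" using similarity_in_G[OF k A t] by (simp add: g_def[abs_def])
  have Ahor: "A (hor p q e P) = A P" for P
  by (simp add: A_def emb_hor)
  have zg: "zc p q e (g P) = k * zc p q e P" for P
    using t by (simp add: g_def linear_cmul[OF linear_zc] linear_add[OF linear_zc] zc_vert A_def zc_hproj horiz_def)
  have hg: "hor p q e (g P) = k *\<^sub>R (A P + t)" for P
    using t by (simp add: g_def linear_cmul[OF linear_hor] linear_add[OF linear_hor] hor_vert Ahor hor_horiz
        A_def[of P] zc_hproj horiz_def)
  have "B (iota_vec P) = iota_vec (g P)" if P: "P \<in> half_space p q e" for P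
  proof (rule pseudosphere_eqI)
    have z: "zc p q e P > 0" using P by (simp add: half_space_def)
    show "B (iota_vec P) \<in> pseudosphere"
      using z by (intro orthogonal_group_pseudosphere[OF B] iota_vec_pseudosphere) simp
    show "iota_vec (g P) \<in> pseudosphere"
      using z k by (intro iota_vec_pseudosphere) (simp add: zg)
    show "ambient_form n0 (B (iota_vec P)) = ambient_form n0 (iota_vec (g P))" "ambient_form n0 (B (iota_vec P)) \<noteq> 0"
      using z k by (simp_all add: n0B ambient_form_n0_iota_vec zg)
    have "hproj (B (iota_vec P)) = (1 / zc p q e P) *\<^sub>R A P + (1 / zc p q e P) *\<^sub>R t"
      by (simp add: iota_vec_def linear_add[OF lin] linear_cmul[OF lin] linear_add[OF linear_hproj]
          linear_cmul[OF linear_hproj] Bn hproj_n0 A_def t_def)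
    then show "hproj (B (iota_vec P)) = hproj (iota_vec (g P))"
      using k by (simp add: hproj_iota_vec hg zg scaleR_add_right)
  qed
  then have "\<forall>P\<in>half_space p q e. induced B (iota p q e c P) = iota p q e c (g P)"
    by (simp add: iota_eq induced_orb[OF B] iota_vec_pseudosphere half_space_def)
  then show ?thesis using gG induced_Isom[OF B] by (auto simp: extensions_def)
qed

section \<open>The inversion is a reflection\<close>

text \<open>
  The reflection in the coordinate \<open>p\<close>, written so as to show that it exchanges \<open>n0\<close> and \<open>m0\<close>.
\<close>

definition swap :: "real ^ 'n \<Rightarrow> real ^ 'n" where
  "swap X = X + ((ambient_form n0 X - ambient_form m0 X) / 2) *\<^sub>R (m0 - n0)"

lemma swap_orthogonal: "swap \<in> orthogonal_group"
proof -
  have "linear swap"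
    by (rule linearI) (simp_all add: swap_def b_simps algebra_simps diff_divide_distrib add_divide_distrib)
  moreover have "ambient_form (swap X) (swap Y) = ambient_form X Y" for X Y
    unfolding swap_def using sym[of X n0] sym[of X m0]
    by (simp only: b_simps null_pair) (simp add: field_simps)
  ultimately show ?thesis by (simp add: orthogonal_group_def)
qed

lemma swap_swap: "swap (swap X) = X"
proof -
  have "ambient_form n0 (swap X) = ambient_form m0 X" "ambient_form m0 (swap X) = ambient_form n0 X"
    by (simp_all add: swap_def b_simps null_pair field_simps)
  then have "swap (swap X) = swap X + ((ambient_form m0 X - ambient_form n0 X) / 2) *\<^sub>R (m0 - n0)"
    by (simp only: swap_def[of "swap X"])
  also have "\<dots> = X + ((ambient_form n0 X - ambient_form m0 X) / 2 + (ambient_form m0 X - ambient_form n0 X) / 2) *\<^sub>R (m0 - n0)"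
    by (simp only: swap_def scaleR_add_left add.assoc)
  also have "(ambient_form n0 X - ambient_form m0 X) / 2 + (ambient_form m0 X - ambient_form n0 X) / 2 = 0" by (simp add: field_simps)
  finally show ?thesis by simp
qed

lemma swap_null_pair: "swap n0 = m0" "swap m0 = n0"
  by (simp_all add: swap_def null_pair)

lemma swap_emb: "swap (emb v) = emb v"
  by (simp add: swap_def null_pair)

text \<open>
  With \<open>s = h(x,y) + z\<^sup>2\<close>, the lift of \<open>(x,y,z)\<close> is \<open>(1/z) ((x,y) + m0 / 2 + (s / 2) n0)\<close>. Exchanging \<open>n0\<close> and
  \<open>m0\<close> gives \<open>(1/z) ((x,y) + (s / 2) m0 + n0 / 2)\<close>, which is the sign of \<open>s\<close> times the lift of the point
  with horizontal part \<open>(x,y) / s\<close> and height \<open>z / \<bar>s\<bar>\<close>; the sign disappears in the quotient.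
\<close>

lemma swap_extends_inversion:
  "induced swap \<in> extensions p q e c (J_dom p q e) (J p q e)"
proof -
  have "induced swap (iota p q e c P) = iota p q e c (J p q e P)" if P: "P \<in> J_dom p q e" for P
  proof -
    define z where "z = zc p q e P"
    define s where "s = h p q e P + z\<^sup>2"
    have z: "z > 0" and s: "s \<noteq> 0" using P by (auto simp: J_dom_def half_space_def z_def s_def)
    have JP: "J p q e P = inverse s *\<^sub>R hor p q e P + vert p q e (\<bar>inverse s\<bar> * z)"
      by (simp add: J_def Let_def s_def z_def)
    have zJ: "zc p q e (J p q e P) = \<bar>inverse s\<bar> * z"
      by (simp add: JP linear_add[OF linear_zc] linear_cmul[OF linear_zc] zc_vert zc_hor)
    have eJ: "emb (J p q e P) = inverse s *\<^sub>R emb P"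
      by (simp add: JP linear_add[OF linear_emb] linear_cmul[OF linear_emb] emb_hor emb_vert)
    have hJ: "h p q e (J p q e P) = (inverse s)\<^sup>2 * h p q e P"
      unfolding h_eq ambient_form_emb_emb[symmetric] eJ by (simp add: b_simps power2_eq_square)
    have "h p q e (J p q e P) + (zc p q e (J p q e P))\<^sup>2 = (inverse s)\<^sup>2 * s"
      unfolding hJ zJ by (simp add: s_def power_mult_distrib distrib_left del: abs_inverse)
    then have hzJ: "h p q e (J p q e P) + (zc p q e (J p q e P))\<^sup>2 = inverse s"
      using s by (simp add: power2_eq_square)
    have lin: "linear swap" using swap_orthogonal by (simp add: orthogonal_group_def)
    have "swap (iota_vec P) = (1 / z) *\<^sub>R emb P + (1 / (2 * z)) *\<^sub>R n0 + (s / (2 * z)) *\<^sub>R m0"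
      by (simp add: iota_vec_def linear_add[OF lin] linear_cmul[OF lin] swap_null_pair swap_emb s_def z_def)
    moreover have "iota_vec (J p q e P) = (inverse s / (\<bar>inverse s\<bar> * z)) *\<^sub>R emb P
        + (1 / (2 * (\<bar>inverse s\<bar> * z))) *\<^sub>R m0 + (inverse s / (2 * (\<bar>inverse s\<bar> * z))) *\<^sub>R n0"
      unfolding iota_vec_def hzJ unfolding zJ eJ by simp
    ultimately have "iota_vec (J p q e P) = sgn s *\<^sub>R swap (iota_vec P)"
      using s z by (cases "s > 0") (simp_all add: field_simps)
    then have "orb (iota_vec (J p q e P)) = orb (swap (iota_vec P))"
      using s by (auto simp: sgn_if)
    then show ?thesis
      using z induced_orb[OF swap_orthogonal iota_vec_pseudosphere] by (simp add: iota_eq z_def)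
  qed
  then show ?thesis using induced_Isom[OF swap_orthogonal] by (simp add: extensions_def)
qed

section \<open>Generation\<close>

text \<open>
  For \<open>a\<close> orthogonal to \<open>n0\<close> this is the Eichler transformation, the linear form of a translation of the
  half-space: the last term is what makes it an isometry.
\<close>

definition eichler :: "real ^ 'n \<Rightarrow> real ^ 'n \<Rightarrow> real ^ 'n" where
  "eichler a X = X + ambient_form n0 X *\<^sub>R a - (ambient_form a X + ambient_form a a / 2 * ambient_form n0 X) *\<^sub>R n0"

lemma eichler_orthogonal:
  assumes "ambient_form n0 a = 0"
  shows "eichler a \<in> orthogonal_group"
proof -
  have "linear (eichler a)"
    by (rule linearI) (simp_all add: eichler_def b_simps algebra_simps)
  moreover have "ambient_form (eichler a X) (eichler a Y) = ambient_form X Y" for X Y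
    unfolding eichler_def using assms sym[of X n0] sym[of X a] sym[of a n0]
    by (simp only: b_simps null_pair) (simp add: algebra_simps)
  ultimately show ?thesis by (simp add: orthogonal_group_def)
qed

lemma eichler_n0: "ambient_form n0 a = 0 \<Longrightarrow> eichler a n0 = n0"
  using sym[of a n0] by (simp add: eichler_def null_pair)

lemma ambient_form_n0_eichler: "ambient_form n0 a = 0 \<Longrightarrow> ambient_form n0 (eichler a X) = ambient_form n0 X"
  by (simp add: eichler_def b_simps null_pair)

abbreviation generators :: "((real ^ 'n) set \<Rightarrow> (real ^ 'n) set) set" where
  "generators \<equiv> (\<Union>g\<in>G p q e. extensions p q e c (half_space p q e) g)
        \<union> extensions p q e c (J_dom p q e) (J p q e)"

abbreviation generated :: "((real ^ 'n) set \<Rightarrow> (real ^ 'n) set) set" where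
  "generated \<equiv> generate (BijGroup (Hpq p q c)) generators"

lemma generated_comp:
  assumes "A \<in> orthogonal_group" "B \<in> orthogonal_group"
    and "induced A \<in> generated" "induced B \<in> generated"
  shows "induced (A \<circ> B) \<in> generated"
  using generate.eng[OF assms(3,4)] induced_mult[OF assms(1,2)] by simp

lemma swap_generated: "induced swap \<in> generated"
  using swap_extends_inversion by (intro generate.incl) blast

text \<open>
  If \<open>B\<close> scales \<open>n0\<close> by a negative number, then \<open>- B\<close> scales it by a positive one and induces the same map.
\<close>

lemma stabilizer_generated:
  assumes B: "B \<in> orthogonal_group" and k: "k \<noteq> 0" and Bn: "B n0 = k *\<^sub>R n0"
  shows "induced B \<in> generated"
proof -
  define B' where "B' = (if k > 0 then B else (\<lambda>X. - B X))"
  have B': "B' \<in> orthogonal_group" using B orthogonal_group_uminus by (simp add: B'_def)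
  have "B' n0 = \<bar>k\<bar> *\<^sub>R n0" using Bn k by (simp add: B'_def)
  from stabilizer_extends_similarity[OF B' _ this] have "induced B' \<in> generated"
    using k by (auto intro!: generate.incl)
  moreover have "induced B' = induced B"
    by (rule induced_unique[OF B]) (use induced_orb[OF B'] in \<open>auto simp: induced_def B'_def\<close>)
  ultimately show ?thesis by simp
qed

text \<open>
  The big Bruhat cell. A null vector \<open>N\<close> with \<open>ambient_form n0 N \<noteq> 0\<close> is determined up to scale by its horizontal
  part relative to \<open>ambient_form n0 N\<close>, which an Eichler transformation translates to \<open>0\<close>; what remains is a
  multiple of \<open>m0\<close>.
\<close>

lemma generated_if_big_cell:
  assumes B: "B \<in> orthogonal_group" and nz: "ambient_form n0 (B n0) \<noteq> 0"
  shows "induced B \<in> generated"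
proof -
  define N where "N = B n0"
  define a where "a = (- 1 / ambient_form n0 N) *\<^sub>R emb (hproj N)"
  have a: "ambient_form n0 a = 0" by (simp add: a_def b_simps null_pair)
  let ?T = "eichler a"
  have TO: "?T \<in> orthogonal_group" and Tn: "?T n0 = n0"
    using a by (rule eichler_orthogonal, rule eichler_n0)
  have "hproj (?T N) = 0"
    using nz by (simp add: eichler_def N_def a_def linear_add[OF linear_hproj] linear_diff[OF linear_hproj]
        linear_cmul[OF linear_hproj] hproj_emb hproj_n0 hor_horiz horiz_def zc_hproj)
  moreover have "ambient_form (?T N) (?T N) = 0"
    using TO B by (simp add: orthogonal_group_def N_def null_pair)
  moreover have n0T: "ambient_form n0 (?T N) = ambient_form n0 N" using ambient_form_n0_eichler[OF a] .
  ultimately have "ambient_form m0 (?T N) = 0"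
    using ambient_form_self[of "?T N"] nz by (simp add: horiz_form_simps N_def)
  then have TN: "?T N = (- ambient_form n0 N / 2) *\<^sub>R m0"
    using decomposition[of "?T N"] n0T \<open>hproj (?T N) = 0\<close> linear_0[OF linear_emb] by simp
  define S where "S = swap \<circ> (?T \<circ> B)"
  have SO: "S \<in> orthogonal_group"
    unfolding S_def using B TO swap_orthogonal by (intro orthogonal_group_compose)
  have "S n0 = (- ambient_form n0 N / 2) *\<^sub>R n0"
    using TN swap_orthogonal linear_cmul[of swap] swap_null_pair(2)
    by (simp add: S_def N_def orthogonal_group_def del: scaleR_minus_left)
  then have S: "induced S \<in> generated"
    using nz by (intro stabilizer_generated[OF SO, of "- ambient_form n0 N / 2"]) (simp_all add: N_def)
  obtain T' where T': "T' \<in> orthogonal_group" "\<And>X. T' (?T X) = X" "\<And>X. ?T (T' X) = X"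
    using orthogonal_group_inverse[OF TO] by blast
  have "T' n0 = 1 *\<^sub>R n0" using T'(2)[of n0] Tn by simp
  then have "induced T' \<in> generated" by (intro stabilizer_generated[OF T'(1), of 1]) auto
  moreover have "T' \<circ> (swap \<circ> S) = B" by (simp add: fun_eq_iff S_def swap_swap T'(2))
  ultimately show ?thesis
    using generated_comp[OF T'(1) orthogonal_group_compose[OF swap_orthogonal SO] _
        generated_comp[OF swap_orthogonal SO swap_generated S]] by simp
qed

lemma generated_if_opposite:
  assumes B: "B \<in> orthogonal_group" and nz: "ambient_form m0 (B n0) \<noteq> 0"
  shows "induced B \<in> generated"
proof -
  have SB: "swap \<circ> B \<in> orthogonal_group" using swap_orthogonal B by (rule orthogonal_group_compose)
  have "ambient_form n0 (swap (B n0)) = ambient_form (swap n0) (swap (swap (B n0)))"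
    using swap_orthogonal by (simp add: orthogonal_group_def)
  then have "ambient_form n0 ((swap \<circ> B) n0) \<noteq> 0" using nz by (simp add: swap_swap swap_null_pair)
  then have "induced (swap \<circ> B) \<in> generated" by (rule generated_if_big_cell[OF SB])
  from generated_comp[OF swap_orthogonal SB swap_generated this]
  show ?thesis by (simp add: o_def swap_swap)
qed

text \<open>
  When \<open>N = B n0\<close> is orthogonal to both \<open>n0\<close> and \<open>m0\<close>, it is horizontal and not zero, so some
  horizontal \<open>a\<close> satisfies \<open>ambient_form a N \<noteq> 0\<close>; the Eichler transformation of \<open>a\<close> then moves \<open>N\<close> off the hyperplane
  orthogonal to \<open>m0\<close>.
\<close>

lemma orthogonal_generated:
  assumes B: "B \<in> orthogonal_group"
  shows "induced B \<in> generated"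
proof -
  define N where "N = B n0"
  consider "ambient_form n0 N \<noteq> 0" | "ambient_form m0 N \<noteq> 0" | "ambient_form n0 N = 0" "ambient_form m0 N = 0" by blast
  then show ?thesis
  proof cases
    case 1
    then show ?thesis using generated_if_big_cell[OF B] by (simp add: N_def)
  next
    case 2
    then show ?thesis using generated_if_opposite[OF B] by (simp add: N_def)
  next
    case 3
    have "n0 \<noteq> 0" using null_pair(3) b_simps(9) by force
    then have "N \<noteq> 0"
      using B b_preserving_eq_0[of B n0] by (auto simp: N_def orthogonal_group_def)
    then obtain X where X: "ambient_form N X \<noteq> 0" using nondeg by blast
    define a where "a = emb (hproj X)"
    have a: "ambient_form n0 a = 0" by (simp add: a_def null_pair)
    have "ambient_form N X = ambient_form N a"
      using 3 sym[of N n0] sym[of N m0]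
      by (subst decomposition[of X]) (simp add: b_simps a_def)
    then have "ambient_form a N \<noteq> 0" using X sym[of a N] by simp
    moreover have "ambient_form m0 (eichler a N) = 2 * ambient_form a N"
      using 3 by (simp add: eichler_def b_simps null_pair a_def)
    moreover have TO: "eichler a \<in> orthogonal_group" and Tn: "eichler a n0 = n0"
      using a by (rule eichler_orthogonal, rule eichler_n0)
    ultimately have TB: "induced (eichler a \<circ> B) \<in> generated"
      by (intro generated_if_opposite orthogonal_group_compose B) (simp_all add: N_def)
    obtain T' where T': "T' \<in> orthogonal_group" "\<And>X. T' (eichler a X) = X" "\<And>X. eichler a (T' X) = X"
      using orthogonal_group_inverse[OF TO] by blast
    have "T' n0 = 1 *\<^sub>R n0" using T'(2)[of n0] Tn by simp
    then have "induced T' \<in> generated" by (intro stabilizer_generated[OF T'(1), of 1]) auto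
    from generated_comp[OF T'(1) orthogonal_group_compose[OF TO B] this TB]
    show ?thesis by (simp add: o_def T'(2))
  qed
qed

theorem generated_eq_Isom: "generated = Isom p q c"
proof
  show "generated \<subseteq> Isom p q c"
    by (rule group.generate_subgroup_incl[OF group_BijGroup _ Isom_subgroup])
      (auto simp: extensions_def)
  show "Isom p q c \<subseteq> generated"
    unfolding Isom_eq_induced using orthogonal_generated by blast
qed

end

theorem theorem7p4:
  fixes p q :: nat and e :: "nat \<Rightarrow> 'm::finite" and c :: "nat \<Rightarrow> 'n::finite"
  assumes "p \<ge> 1"
    and "bij_betw e {1..p + q} (UNIV :: 'm set)"
    and "bij_betw c {1..p + q + 1} (UNIV :: 'n set)"
  shows "generate (BijGroup (Hpq p q c))
      ((\<Union>g\<in>G p q e. extensions p q e c (half_space p q e) g)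
        \<union> extensions p q e c (J_dom p q e) (J p q e))
    = Isom p q c"
proof -
  interpret half_space_model p q e c
    using assms by unfold_locales
  show ?thesis by (rule generated_eq_Isom)
qed

end
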